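(* Let $r : \mathbb{R}^2 \to (0,\infty)$ be an admissible radius function and let $E \subseteq \mathbb{R}^2$ be a $1$-rectifiable set with $\mathcal{H}^1(E) > 0$. If $$\mathcal{C} = \bigcup_{v \in E} C(v, r(v)),$$ then $\mathcal{C}$ has positive two-dimensional Lebesgue measure.
   Context: $\mathcal{H}^1$ denotes $1$-dimensional Hausdorff measure. A Borel set $E \subseteq \mathbb{R}^2$ is $1$-rectifiable if there are Lipschitz maps $f_j : \mathbb{R} \to \mathbb{R}^2$, $j \ge 1$, with $\mathcal{H}^1\big(E \setminus \bigcup_{j=1}^\infty f_j(\mathbb{R})\big) = 0$. $C(v,\rho) = \{w \in \mathbb{R}^2 : |w - v| = \rho\}$ is the circle of center $v$ and radius $\rho$. A function $r : \mathbb{R}^2 \to (0,\infty)$ is an admissible radius function if: (1) there exist real numbers $a, b$ with $0 < a \le r(z) \le b < \infty$ for all $z \in \mathbb{R}^2$; (2) $r$ is differentiable (everywhere) with $\|\nabla r\|_\infty < \infty$; and (3) the partial derivatives $r_x$ and $r_y$ do not change sign (i.e. each of them is either $\ge 0$ on all of $\mathbb{R}^2$ or $\le 0$ on all of $\mathbb{R}^2$). *)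

theory Defs
  imports "HOL-Analysis.Analysis"
begin

(* The library's diameter is real-valued and unspecified on unbounded sets, hence the
   boundedness condition on the covering sets. Empty covering sets are allowed
   (diameter 0), so finite covers are included. *)
definition hausdorff1_pre :: "real \<Rightarrow> 'a::metric_space set \<Rightarrow> ennreal" where
  "hausdorff1_pre \<delta> A =
     (INF U \<in> {U :: nat \<Rightarrow> 'a set.
                 A \<subseteq> (\<Union>i. U i) \<and> (\<forall>i. bounded (U i) \<and> diameter (U i) \<le> \<delta>)}.
        \<Sum>i. ennreal (diameter (U i)))"

(* One-dimensional Hausdorff (outer) measure, normalised to agree with length;
   the supremum is the limit as delta tends to 0, by monotonicity. *)
definition hausdorff1 :: "'a::metric_space set \<Rightarrow> ennreal" where
  "hausdorff1 A = (SUP \<delta> \<in> {0<..}. hausdorff1_pre \<delta> A)"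

definition one_rectifiable :: "(real^2) set \<Rightarrow> bool" where
  "one_rectifiable E \<longleftrightarrow>
     E \<in> sets borel \<and>
     (\<exists>f :: nat \<Rightarrow> real \<Rightarrow> real^2.
        (\<forall>j. \<exists>L. L-lipschitz_on UNIV (f j)) \<and>
        hausdorff1 (E - (\<Union>j. range (f j))) = 0)"

definition partial_deriv :: "'n \<Rightarrow> (real^'n::finite \<Rightarrow> real) \<Rightarrow> real^'n \<Rightarrow> real" where
  "partial_deriv i r z = deriv (\<lambda>t. r (z + t *\<^sub>R axis i 1)) 0"

definition gradient :: "(real^'n::finite \<Rightarrow> real) \<Rightarrow> real^'n \<Rightarrow> real^'n" where
  "gradient r z = (\<chi> i. partial_deriv i r z)"

(* The sup norm of the gradient is the L-infinity norm, so its finiteness is an almost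
   everywhere bound. For an everywhere differentiable function this is equivalent to an
   everywhere bound. Each partial derivative has its own sign. *)
definition admissible_radius :: "(real^2 \<Rightarrow> real) \<Rightarrow> bool" where
  "admissible_radius r \<longleftrightarrow>
     (\<exists>a b. 0 < a \<and> (\<forall>z. a \<le> r z \<and> r z \<le> b)) \<and>
     (\<forall>z. r differentiable (at z)) \<and>
     (\<exists>M. AE z in lebesgue. norm (gradient r z) \<le> M) \<and>
     (\<forall>i. (\<forall>z. 0 \<le> partial_deriv i r z) \<or> (\<forall>z. partial_deriv i r z \<le> 0))"

end

theory Submission
  imports Defs
begin

text \<open>
  Parametrise: if \<open>f\<close> is one of the Lipschitz curves covering \<open>E\<close> up to a null set and
  \<open>e \<theta>\<close> is the unit vector at angle \<open>\<theta>\<close>, the circles centred on the curve are the image of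
  \<open>\<Phi> (t, \<theta>) = f t + r (f t) e \<theta>\<close>. At a point where \<open>f\<close> is differentiable the Jacobian of
  \<open>\<Phi>\<close> is, up to sign, \<open>r (f t) (f' \<bullet> e \<theta> + \<nabla>r \<bullet> f')\<close>, with \<open>\<nabla>r\<close> taken at \<open>f t\<close>.
  If \<open>f' \<noteq> 0\<close> this is a nonzero trigonometric polynomial in \<open>\<theta>\<close>, so it is nonzero on a nonempty
  open set of angles.

  Suppose the union of the circles were null. Where the Jacobian is nonzero, \<open>\<Phi>\<close> locally
  expands distances from below, hence a set of such points with null image is null
  (\<open>negligible_of_negligible_image\<close>). By Fubini, \<open>f\<close> has a nonzero derivative almost nowhere
  on \<open>f -` E\<close> (\<open>negligible_regular_parameters\<close>). By Rademacher's theorem on the line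
  (\<open>Rademacher_curve\<close>) the derivative then exists and vanishes almost everywhere on \<open>f -` E\<close>,
  and a curve maps such a set to a set of length zero (\<open>hausdorff1_critical_values\<close>,
  \<open>hausdorff1_image_negligible\<close>). Thus every piece of \<open>E\<close> has length zero, against the
  assumption of positive length.

  Two further points use that \<open>r\<close> is Lipschitz (\<open>admissible_radius_lipschitz\<close>). The union of the
  circles is Lebesgue measurable: the circles centred on the part of \<open>E\<close> that lies on a curve
  form the image of a Borel set under a Lipschitz map between planes, and the circles centred on
  the rest of \<open>E\<close> form a null set, being covered by thin annuli
  (\<open>negligible_circles_over_null\<close>).
\<close>

section \<open>Vitali coverings on the line and Rademacher's theorem\<close>

lemma countable_nat_index:
  assumes "countable C"
  obtains I :: "nat set" and h where "bij_betw h I C"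
  by (metis assms bij_betw_from_nat_into countableE_bij)

text \<open>
  Coverings are indexed by \<open>nat\<close> in the definition of Hausdorff measure, while covering lemmas
  produce arbitrary countable families. The indices outside \<open>I\<close> contribute empty sets, which
  allows for finite families.
\<close>
lemma disjoint_family_nat_sequence:
  fixes B :: "'i \<Rightarrow> 'a::euclidean_space set"
  assumes "countable C" "disjoint_family_on B C"
    and "\<And>i. i \<in> C \<Longrightarrow> B i \<in> sets lebesgue" "\<And>i. i \<in> C \<Longrightarrow> B i \<subseteq> U" "U \<in> sets lebesgue"
  obtains I :: "nat set" and h where "bij_betw h I C"
    "(\<Sum>n. if n \<in> I then emeasure lebesgue (B (h n)) else 0) \<le> emeasure lebesgue U"
proof -
  obtain I :: "nat set" and h where h: "bij_betw h I C"
    using countable_nat_index[OF assms(1)] .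
  define W where "W n = (if n \<in> I then B (h n) else {})" for n
  have hC: "h n \<in> C" if "n \<in> I" for n using h that by (auto simp: bij_betw_def)
  have inj: "inj_on h I" using h by (auto simp: bij_betw_def)
  have "disjoint_family W"
    unfolding disjoint_family_on_def W_def
    using assms(2) hC inj by (auto simp: disjoint_family_on_def inj_on_def) blast
  moreover have "range W \<subseteq> sets lebesgue" using assms(3) hC by (auto simp: W_def)
  ultimately have "(\<Sum>n. emeasure lebesgue (W n)) = emeasure lebesgue (\<Union>n. W n)"
    by (intro suminf_emeasure) auto
  also have "\<dots> \<le> emeasure lebesgue U"
    using assms(4,5) hC by (intro emeasure_mono) (auto simp: W_def split: if_splits)
  also have "(\<lambda>n. emeasure lebesgue (W n)) = (\<lambda>n. if n \<in> I then emeasure lebesgue (B (h n)) else 0)"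
    by (auto simp: W_def)
  finally show ?thesis using h that by simp
qed

text \<open>
  Vitali's covering theorem for closed intervals that only have to contain the point, not to be
  centred at it. Disjointness survives only as a bound on the total length; degenerate
  intervals fill up the sequence.
\<close>
lemma Vitali_covering_intervals:
  fixes S U :: "real set"
  assumes "open U" "S \<subseteq> U"
    and fine: "\<And>x d. x \<in> S \<Longrightarrow> d > 0 \<Longrightarrow>
       \<exists>u v. u < v \<and> x \<in> {u..v} \<and> v - u < d \<and> P u v"
  obtains u v :: "nat \<Rightarrow> real" where
    "\<And>n. u n \<le> v n" "\<And>n. u n = v n \<or> P (u n) (v n)"
    "negligible (S - (\<Union>n. {u n..v n}))"
    "(\<Sum>n. ennreal (v n - u n)) \<le> emeasure lebesgue U"
proof -
  define K where "K = {p :: real \<times> real. fst p < snd p \<and> {fst p..snd p} \<subseteq> U \<and> P (fst p) (snd p)}"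
  define a where "a p = (fst p + snd p) / 2" for p :: "real \<times> real"
  define r where "r p = (snd p - fst p) / 2" for p :: "real \<times> real"
  have cb: "cball (a p) (r p) = {fst p..snd p}" for p
    by (simp add: cball_eq_atLeastAtMost a_def r_def field_simps)
  obtain C where C: "countable C" "C \<subseteq> K"
     "pairwise (\<lambda>i j. disjnt (cball (a i) (r i)) (cball (a j) (r j))) C"
     "negligible (S - (\<Union>i \<in> C. cball (a i) (r i)))"
  proof (rule Vitali_covering_theorem_cballs[of K r S a])
    show "0 < r i" if "i \<in> K" for i using that by (auto simp: K_def r_def)
    fix x d :: real assume x: "x \<in> S" and d: "0 < d"
    obtain e where e: "e > 0" "ball x e \<subseteq> U"
      using assms x by (meson openE subsetD)
    obtain u v where uv: "u < v" "x \<in> {u..v}" "v - u < min d e" "P u v"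
      using fine[OF x, of "min d e"] d e by auto
    have "{u..v} \<subseteq> U" using uv e by (force simp: dist_real_def)
    then have "(u,v) \<in> K" using uv by (auto simp: K_def)
    moreover have "r (u,v) < d" using uv by (auto simp: r_def)
    ultimately show "\<exists>i. i \<in> K \<and> x \<in> cball (a i) (r i) \<and> r i < d"
      using uv(2) cb by (intro exI[of _ "(u,v)"]) auto
  qed
  define B where "B = (\<lambda>p::real \<times> real. {fst p..snd p})"
  have "disjoint_family_on B C"
    using C(3) unfolding disjoint_family_on_def pairwise_def disjnt_def cb B_def by blast
  then obtain I h where h: "bij_betw h (I::nat set) C"
    and sum: "(\<Sum>n. if n \<in> I then emeasure lebesgue (B (h n)) else 0) \<le> emeasure lebesgue U"
  proof (rule disjoint_family_nat_sequence[OF C(1), of B U])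
    show "B i \<in> sets lebesgue" for i by (simp add: B_def)
    show "B i \<subseteq> U" if "i \<in> C" for i using that C(2) by (auto simp: B_def K_def)
    show "U \<in> sets lebesgue" using \<open>open U\<close> by auto
  qed
  have hK: "h n \<in> K" if "n \<in> I" for n using h that C(2) by (auto simp: bij_betw_def)
  define u where "u n = (if n \<in> I then fst (h n) else 0)" for n
  define v where "v n = (if n \<in> I then snd (h n) else 0)" for n
  show ?thesis
  proof (rule that[of u v])
    show le: "u n \<le> v n" for n using hK[of n] by (auto simp: u_def v_def K_def)
    show "u n = v n \<or> P (u n) (v n)" for n using hK[of n] by (auto simp: u_def v_def K_def)
    have "(\<Union>i\<in>C. cball (a i) (r i)) \<subseteq> (\<Union>n. {u n..v n})"
    proof -
      have "C = h ` I" using h by (auto simp: bij_betw_def)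
      then show ?thesis unfolding cb by (force simp: u_def v_def)
    qed
    then show "negligible (S - (\<Union>n. {u n..v n}))"
      using C(4) by (elim negligible_subset) blast
    have "ennreal (v n - u n) = (if n \<in> I then emeasure lebesgue (B (h n)) else 0)" for n
      using hK[of n] by (auto simp: u_def v_def B_def K_def)
    then show "(\<Sum>n. ennreal (v n - u n)) \<le> emeasure lebesgue U" using sum by simp
  qed
qed

text \<open>
  If near each point of \<open>S\<close> some arbitrarily short interval is stretched by at most the factor \<open>p\<close>,
  then a Vitali selection of such intervals inside an open set slightly larger than \<open>S\<close> covers
  almost all of \<open>S\<close>, and its image covers almost all of \<open>\<phi> ` S\<close> at \<open>p\<close> times the total length.
  The outer measure appears because \<open>S\<close> need not be measurable.
\<close>
lemma outer_measure_image_le: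
  fixes \<phi> :: "real \<Rightarrow> real"
  assumes "mono \<phi>" and null: "\<And>N. negligible N \<Longrightarrow> negligible (\<phi> ` N)" and "p > 0"
    and slope: "\<And>x d. x \<in> S \<Longrightarrow> d > 0 \<Longrightarrow>
       \<exists>u v. u < v \<and> x \<in> {u..v} \<and> v - u < d \<and> \<phi> v - \<phi> u \<le> p * (v - u)"
  shows "outer_measure_of lebesgue (\<phi> ` S) \<le> ennreal p * outer_measure_of lebesgue S"
proof (rule ennreal_le_epsilon)
  fix e :: real assume "0 < e"
  obtain E where E: "E \<in> sets lebesgue" "S \<subseteq> E" "outer_measure_of lebesgue S = emeasure lebesgue E"
    using outer_measure_of_attain[of S lebesgue] by auto
  have "e / p > 0" using \<open>0 < e\<close> \<open>p > 0\<close> by simp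
  then obtain U where U: "open U" "E \<subseteq> U" "U - E \<in> lmeasurable" "emeasure lebesgue (U - E) < ennreal (e / p)"
    using sets_lebesgue_outer_open[OF E(1)] by metis
  have "emeasure lebesgue U \<le> emeasure lebesgue E + emeasure lebesgue (U - E)"
    using emeasure_subadditive[of E lebesgue "U - E"] E(1) U by (simp add: Un_absorb1 fmeasurableD)
  also have "\<dots> \<le> emeasure lebesgue E + ennreal (e / p)"
    using U(4) by (intro add_mono) auto
  finally have Ule: "emeasure lebesgue U \<le> emeasure lebesgue E + ennreal (e / p)" .
  obtain u v :: "nat \<Rightarrow> real" where uv:
    "\<And>n. u n \<le> v n" "\<And>n. u n = v n \<or> \<phi> (v n) - \<phi> (u n) \<le> p * (v n - u n)"
    "negligible (S - (\<Union>n. {u n..v n}))"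
    "(\<Sum>n. ennreal (v n - u n)) \<le> emeasure lebesgue U"
    by (rule Vitali_covering_intervals[of U S "\<lambda>u v. \<phi> v - \<phi> u \<le> p * (v - u)"])
       (use U E slope in auto)
  define N where "N = \<phi> ` (S - (\<Union>n. {u n..v n}))"
  have N: "N \<in> null_sets lebesgue"
    using null[OF uv(3)] by (simp add: N_def negligible_iff_null_sets)
  define J where "J = (\<Union>n. {\<phi> (u n)..\<phi> (v n)})"
  have "\<phi> ` S \<subseteq> N \<union> J"
  proof
    fix y assume "y \<in> \<phi> ` S"
    then obtain x where x: "x \<in> S" "y = \<phi> x" by auto
    show "y \<in> N \<union> J"
    proof (cases "x \<in> (\<Union>n. {u n..v n})")
      case True
      then obtain n where "u n \<le> x" "x \<le> v n" by auto
      then have "\<phi> (u n) \<le> y" "y \<le> \<phi> (v n)" using x monoD[OF \<open>mono \<phi>\<close>] by auto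
      then show ?thesis by (auto simp: J_def)
    next
      case False
      then show ?thesis using x by (auto simp: N_def)
    qed
  qed
  then have "outer_measure_of lebesgue (\<phi> ` S) \<le> outer_measure_of lebesgue (N \<union> J)"
    by (rule outer_measure_of_mono)
  also have "\<dots> = emeasure lebesgue (N \<union> J)"
    using N by (intro outer_measure_of_eq) (auto simp: J_def)
  also have "\<dots> = emeasure lebesgue J"
    using N emeasure_Un_null_set[of J lebesgue N] by (simp add: J_def Un_commute)
  also have "\<dots> \<le> (\<Sum>n. emeasure lebesgue {\<phi> (u n)..\<phi> (v n)})"
    unfolding J_def by (intro emeasure_subadditive_countably) auto
  also have "\<dots> \<le> (\<Sum>n. ennreal p * ennreal (v n - u n))"
  proof (intro suminf_le)
    fix n
    have "\<phi> (u n) \<le> \<phi> (v n)" using uv(1) \<open>mono \<phi>\<close> by (auto simp: mono_def)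
    moreover have "\<phi> (v n) - \<phi> (u n) \<le> p * (v n - u n)" using uv(2)[of n] by auto
    ultimately show "emeasure lebesgue {\<phi> (u n)..\<phi> (v n)} \<le> ennreal p * ennreal (v n - u n)"
      using \<open>p > 0\<close> uv(1)[of n] by (simp add: ennreal_mult[symmetric])
  qed auto
  also have "\<dots> = ennreal p * (\<Sum>n. ennreal (v n - u n))" by simp
  also have "\<dots> \<le> ennreal p * (emeasure lebesgue E + ennreal (e / p))"
    using uv(4) Ule by (intro mult_left_mono) auto
  also have "\<dots> = ennreal p * outer_measure_of lebesgue S + ennreal e"
    using \<open>p > 0\<close> \<open>0 < e\<close> by (simp add: E(3) distrib_left ennreal_mult[symmetric])
  finally show "outer_measure_of lebesgue (\<phi> ` S) \<le> ennreal p * outer_measure_of lebesgue S + ennreal e" .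
qed

lemma negligible_lipschitz_image:
  fixes f :: "'a::euclidean_space \<Rightarrow> 'b::euclidean_space"
  assumes "DIM('a) \<le> DIM('b)" "negligible S" "L-lipschitz_on S f"
  shows "negligible (f ` S)"
proof (rule negligible_locally_Lipschitz_image[OF assms(1,2)])
  fix x assume "x \<in> S"
  then show "\<exists>T B. open T \<and> x \<in> T \<and> (\<forall>y\<in>S \<inter> T. norm (f y - f x) \<le> B * norm (y - x))"
    using lipschitz_onD[OF assms(3)]
    by (intro exI[of _ UNIV] exI[of _ L]) (auto simp: dist_norm)
qed

definition slope :: "(real \<Rightarrow> real) \<Rightarrow> real \<Rightarrow> real \<Rightarrow> real" where
  "slope \<phi> x y = (\<phi> y - \<phi> x) / (y - x)"

lemma slope_commute: "slope \<phi> x y = slope \<phi> y x"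
  unfolding slope_def by (metis minus_diff_eq minus_divide_divide)

text \<open>
  Slopes below \<open>p\<close> give \<open>|\<phi> ` S| \<le> p |S|\<close>. Slopes above \<open>q\<close> are slopes below \<open>1 / q\<close> for the
  inverse function and give \<open>|S| \<le> |\<phi> ` S| / q\<close>. Together \<open>|S| \<le> (p / q) |S|\<close>, which forces
  \<open>|S| = 0\<close> since \<open>|S|\<close> is finite. The lower bound on the increments of \<open>\<phi>\<close> makes
  \<open>\<phi>\<close> a bijection whose inverse also preserves null sets.
\<close>
lemma negligible_oscillating_slopes:
  fixes \<phi> :: "real \<Rightarrow> real"
  assumes lip: "L-lipschitz_on UNIV \<phi>" and exp: "\<And>x y. x \<le> y \<Longrightarrow> y - x \<le> \<phi> y - \<phi> x"
    and "0 < p" "p < q" "bounded S"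
    and below: "\<And>x. x \<in> S \<Longrightarrow> \<exists>\<^sub>F y in at x. slope \<phi> x y < p"
    and above: "\<And>x. x \<in> S \<Longrightarrow> \<exists>\<^sub>F y in at x. slope \<phi> x y > q"
  shows "negligible S"
proof -
  have cont: "continuous_on UNIV \<phi>" using lip by (rule lipschitz_on_continuous_on)
  have sm: "\<phi> x < \<phi> y" if "x < y" for x y using exp[of x y] that by simp
  have inj: "inj \<phi>" by (metis injI less_irrefl linorder_neqE_linordered_idom sm)
  have "surj \<phi>"
    unfolding surj_def
  proof
    fix y
    define M where "M = \<bar>y\<bar> + \<bar>\<phi> 0\<bar>"
    have "M \<ge> 0" by (simp add: M_def)
    then have "M \<le> \<phi> 0 - \<phi> (-M)" "M \<le> \<phi> M - \<phi> 0" using exp[of "-M" 0] exp[of 0 M] by simp_all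
    then have "\<phi> (-M) \<le> y" "y \<le> \<phi> M" unfolding M_def by linarith+
    then show "\<exists>x. y = \<phi> x"
      using IVT'[of \<phi> "-M" y M] \<open>M \<ge> 0\<close> continuous_on_subset[OF cont] by auto
  qed
  define \<psi> where "\<psi> = inv \<phi>"
  have \<phi>\<psi>[simp]: "\<phi> (\<psi> z) = z" for z using \<open>surj \<phi>\<close> by (simp add: \<psi>_def surj_f_inv_f)
  have \<psi>\<phi>[simp]: "\<psi> (\<phi> z) = z" for z using inj by (simp add: \<psi>_def)
  have mono: "mono \<phi>" using sm by (metis less_imp_le monoI order_le_less)
  have mono': "mono \<psi>"
    by (rule monoI) (metis \<phi>\<psi> leD leI sm)
  have lip': "1-lipschitz_on UNIV \<psi>"
  proof (rule lipschitz_onI)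
    fix x y show "dist (\<psi> x) (\<psi> y) \<le> 1 * dist x y"
      using exp[of "\<psi> x" "\<psi> y"] exp[of "\<psi> y" "\<psi> x"] by (auto simp: dist_real_def abs_if)
  qed simp
  have "outer_measure_of lebesgue (\<phi> ` S) \<le> ennreal p * outer_measure_of lebesgue S"
  proof (rule outer_measure_image_le[OF mono])
    show "negligible (\<phi> ` N)" if "negligible N" for N
      using negligible_lipschitz_image[OF _ that lipschitz_on_subset[OF lip]] by simp
    fix x d :: real assume x: "x \<in> S" and "d > 0"
    have "\<forall>\<^sub>F y in at x. y \<noteq> x \<and> dist y x < d"
      using \<open>d > 0\<close> by (auto simp: eventually_at)
    then obtain y where y: "slope \<phi> x y < p" "y \<noteq> x" "dist y x < d"
      using frequently_eventually_frequently[OF below[OF x]] frequently_ex by blast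
    show "\<exists>u v. u < v \<and> x \<in> {u..v} \<and> v - u < d \<and> \<phi> v - \<phi> u \<le> p * (v - u)"
    proof (cases "x < y")
      case True
      then show ?thesis using y
        by (intro exI[of _ x] exI[of _ y]) (auto simp: slope_def divide_simps dist_real_def)
    next
      case False
      then have "y < x" using y by auto
      moreover have "slope \<phi> y x < p" using y slope_commute[of \<phi> x y] by simp
      ultimately show ?thesis using y(3)
        by (intro exI[of _ y] exI[of _ x]) (auto simp: slope_def divide_simps dist_real_def)
    qed
  qed (use \<open>0 < p\<close> in auto)
  note 1 = this
  have "outer_measure_of lebesgue (\<psi> ` (\<phi> ` S)) \<le> ennreal (1 / q) * outer_measure_of lebesgue (\<phi> ` S)"
  proof (rule outer_measure_image_le[OF mono'])
    show "negligible (\<psi> ` N)" if "negligible N" for N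
      using negligible_lipschitz_image[OF _ that lipschitz_on_subset[OF lip']] by simp
    show "0 < 1 / q" using \<open>0 < p\<close> \<open>p < q\<close> by simp
    fix z d :: real assume z: "z \<in> \<phi> ` S" and "d > 0"
    then obtain x where x: "x \<in> S" "z = \<phi> x" by auto
    have "(\<phi> \<longlongrightarrow> \<phi> x) (at x)"
      using cont by (simp add: continuous_on_eq_continuous_at isCont_def)
    then have "\<forall>\<^sub>F y in at x. dist (\<phi> y) (\<phi> x) < d" using \<open>d > 0\<close> by (rule tendstoD)
    moreover have "\<forall>\<^sub>F y in at x. y \<noteq> x" by (auto simp: eventually_at_filter)
    ultimately have "\<forall>\<^sub>F y in at x. y \<noteq> x \<and> dist (\<phi> y) (\<phi> x) < d" by eventually_elim auto
    then obtain y where y: "slope \<phi> x y > q" "y \<noteq> x" "dist (\<phi> y) (\<phi> x) < d"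
      using frequently_eventually_frequently[OF above[OF x(1)]] frequently_ex by blast
    have "q > 0" using \<open>0 < p\<close> \<open>p < q\<close> by simp
    show "\<exists>u v. u < v \<and> z \<in> {u..v} \<and> v - u < d \<and> \<psi> v - \<psi> u \<le> 1 / q * (v - u)"
    proof (cases "x < y")
      case True
      then show ?thesis using y sm[OF True] x \<open>q > 0\<close>
        by (intro exI[of _ "\<phi> x"] exI[of _ "\<phi> y"])
           (auto simp: slope_def field_simps dist_real_def)
    next
      case False
      then have "y < x" using y by auto
      moreover have "slope \<phi> y x > q" using y slope_commute[of \<phi> x y] by simp
      ultimately show ?thesis using y(3) sm[of y x] x \<open>q > 0\<close>
        by (intro exI[of _ "\<phi> y"] exI[of _ "\<phi> x"])
           (auto simp: slope_def field_simps dist_real_def)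
    qed
  qed
  also have "\<dots> \<le> ennreal (1 / q) * (ennreal p * outer_measure_of lebesgue S)"
    using 1 by (rule mult_left_mono) simp
  also have "\<psi> ` (\<phi> ` S) = S" by (simp add: image_image)
  finally have "outer_measure_of lebesgue S
      \<le> ennreal (1 / q) * (ennreal p * outer_measure_of lebesgue S)" .
  then have "outer_measure_of lebesgue S \<le> (ennreal (1 / q) * ennreal p) * outer_measure_of lebesgue S"
    by (simp only: mult.assoc)
  moreover have "ennreal (1 / q) * ennreal p = ennreal (p / q)"
    using \<open>0 < p\<close> \<open>p < q\<close> by (simp add: ennreal_mult[symmetric])
  ultimately have *: "outer_measure_of lebesgue S \<le> ennreal (p / q) * outer_measure_of lebesgue S"
    by (simp only:)
  obtain B where B: "S \<subseteq> ball 0 B" using bounded_subset_ballD[OF \<open>bounded S\<close>] by metis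
  have "outer_measure_of lebesgue S \<le> outer_measure_of lebesgue (ball (0::real) B)"
    using B by (rule outer_measure_of_mono)
  also have "\<dots> < \<infinity>" using emeasure_bounded_finite[of "ball (0::real) B"] by simp
  finally obtain m where m: "outer_measure_of lebesgue S = ennreal m" "m \<ge> 0"
    by (cases "outer_measure_of lebesgue S") auto
  have "m \<le> p / q * m"
    using * m \<open>0 < p\<close> \<open>p < q\<close> by (simp add: ennreal_mult[symmetric])
  then have "m * (q - p) \<le> 0" using \<open>0 < p\<close> \<open>p < q\<close> by (simp add: field_simps)
  then have "m = 0" using m(2) \<open>p < q\<close> by (simp add: mult_le_0_iff)
  obtain E where "E \<in> sets lebesgue" "S \<subseteq> E" "outer_measure_of lebesgue S = emeasure lebesgue E"
    using outer_measure_of_attain[of S lebesgue] by auto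
  then show ?thesis
    using m \<open>m = 0\<close> by (metis ennreal_0 negligible_iff_emeasure0 negligible_subset)
qed

text \<open>
  The limit is the lower limit of \<open>s\<close>; if \<open>s\<close> exceeded some larger rational \<open>q\<close> frequently, it would
  oscillate across a rational interval. Restricting to rationals leaves countably many exceptional sets
  in the application to slopes.
\<close>
lemma convergent_if_no_oscillation:
  fixes s :: "'a \<Rightarrow> real"
  assumes lo: "\<forall>\<^sub>F y in F. a \<le> s y" and hi: "\<forall>\<^sub>F y in F. s y \<le> b" and "F \<noteq> bot"
    and "\<And>p q. p \<in> \<rat> \<Longrightarrow> q \<in> \<rat> \<Longrightarrow> a < p \<Longrightarrow> p < q \<Longrightarrow> \<not> ((\<exists>\<^sub>F y in F. s y < p) \<and> (\<exists>\<^sub>F y in F. s y > q))"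
  shows "\<exists>l. (s \<longlongrightarrow> l) F"
proof -
  define A where "A = {p. \<forall>\<^sub>F y in F. p \<le> s y}"
  have "a \<in> A" using lo by (simp add: A_def)
  have bd: "p \<le> b" if "p \<in> A" for p
  proof -
    have "\<forall>\<^sub>F y in F. p \<le> s y \<and> s y \<le> b" using that hi by (auto simp: A_def eventually_conj)
    then show ?thesis using \<open>F \<noteq> bot\<close> by (metis (mono_tags, lifting) eventually_happens order_trans)
  qed
  then have bdd: "bdd_above A" by (rule bdd_aboveI)
  have down: "p \<in> A" if less: "p < Sup A" for p
  proof -
    have "A \<noteq> {}" using \<open>a \<in> A\<close> by auto
    then obtain p' where "p' \<in> A" "p < p'" using less_cSup_iff[of A p] bdd less by metis
    then show ?thesis unfolding A_def by (auto elim: eventually_mono)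
  qed
  have "(s \<longlongrightarrow> Sup A) F"
  proof (rule order_tendstoI)
    fix c assume "c < Sup A"
    then obtain p where "c < p" "p < Sup A" using dense by blast
    then have "\<forall>\<^sub>F y in F. p \<le> s y" using down[of p] by (simp add: A_def)
    then show "\<forall>\<^sub>F y in F. c < s y" by eventually_elim (use \<open>c < p\<close> in simp)
  next
    fix c assume c: "Sup A < c"
    obtain q where q: "q \<in> \<rat>" "Sup A < q" "q < c" using Rats_dense_in_real[OF c] by blast
    obtain p where p: "p \<in> \<rat>" "Sup A < p" "p < q" using Rats_dense_in_real[OF q(2)] by blast
    have "p \<notin> A" using p bdd cSup_upper leD by blast
    then have "\<exists>\<^sub>F y in F. s y < p" by (simp add: A_def not_eventually not_le)
    moreover have "a < p" using cSup_upper[OF \<open>a \<in> A\<close> bdd] p by simp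
    ultimately have "\<not> (\<exists>\<^sub>F y in F. s y > q)" using assms(4) p q by blast
    then have "\<forall>\<^sub>F y in F. s y \<le> q" by (simp add: not_frequently not_less)
    then show "\<forall>\<^sub>F y in F. s y < c" by eventually_elim (use q in simp)
  qed
  then show ?thesis by blast
qed

text \<open>
  Adding a linear function of slope \<open>L + 1\<close> does not affect differentiability and brings all
  slopes into the interval from \<open>1\<close> to \<open>2 L + 1\<close>, so the function becomes increasing and
  bi-Lipschitz.
\<close>
theorem Rademacher_real:
  fixes g :: "real \<Rightarrow> real"
  assumes lip: "L-lipschitz_on UNIV g"
  shows "negligible {x. \<not> g differentiable (at x)}"
proof -
  have "L \<ge> 0" using lip by (rule lipschitz_on_nonneg)
  define \<phi> where "\<phi> x = g x + (L + 1) * x" for x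
  have gl: "\<bar>g x - g y\<bar> \<le> L * \<bar>x - y\<bar>" for x y
    using lipschitz_onD[OF lip, of x y] by (simp add: dist_real_def)
  have exp: "y - x \<le> \<phi> y - \<phi> x" if "x \<le> y" for x y
    using gl[of x y] that by (simp add: \<phi>_def abs_if algebra_simps split: if_splits)
  have exp': "\<phi> y - \<phi> x \<le> (2 * L + 1) * (y - x)" if "x \<le> y" for x y
    using gl[of x y] that by (simp add: \<phi>_def abs_if algebra_simps split: if_splits)
  have lip\<phi>: "(2 * L + 1)-lipschitz_on UNIV \<phi>"
  proof (rule lipschitz_onI)
    fix x y
    show "dist (\<phi> x) (\<phi> y) \<le> (2 * L + 1) * dist x y"
      using exp[of x y] exp[of y x] exp'[of x y] exp'[of y x]
      by (cases "x \<le> y") (auto simp: dist_real_def abs_if)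
  qed (use \<open>L \<ge> 0\<close> in simp)
  have s1: "1 \<le> slope \<phi> x y" if "y \<noteq> x" for x y
    using exp[of x y] exp[of y x] that
    by (cases "x < y") (auto simp: slope_def divide_simps)
  have s2: "slope \<phi> x y \<le> 2 * L + 1" if "y \<noteq> x" for x y
    using exp'[of x y] exp'[of y x] that
    by (cases "x < y") (auto simp: slope_def divide_simps algebra_simps)
  define bad where "bad p q = {x. (\<exists>\<^sub>F y in at x. slope \<phi> x y < p) \<and> (\<exists>\<^sub>F y in at x. slope \<phi> x y > q)}" for p q
  have neg: "negligible (bad p q)" if "1 < p" "p < q" for p q
    unfolding negligible_on_intervals[of "bad p q"]
  proof (intro allI)
    fix a b
    show "negligible (bad p q \<inter> cbox a b)"
      using that
      by (intro negligible_oscillating_slopes[OF lip\<phi> exp, of p q])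
         (auto simp: bad_def intro: bounded_Int)
  qed
  have "{x. \<not> g differentiable (at x)} \<subseteq> (\<Union>p\<in>\<rat>. \<Union>q\<in>\<rat>. if 1 < p \<and> p < q then bad p q else {})"
  proof (rule subsetI, rule ccontr)
    fix x assume x: "x \<in> {x. \<not> g differentiable (at x)}"
      and nx: "x \<notin> (\<Union>p\<in>\<rat>. \<Union>q\<in>\<rat>. if 1 < p \<and> p < q then bad p q else {})"
    have ev: "\<forall>\<^sub>F y in at x. y \<noteq> x" by (auto simp: eventually_at_filter)
    have "\<exists>l. (slope \<phi> x \<longlongrightarrow> l) (at x)"
    proof (rule convergent_if_no_oscillation[where a=1 and b="2 * L + 1"])
      show "\<forall>\<^sub>F y in at x. 1 \<le> slope \<phi> x y" using ev by eventually_elim (rule s1)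
      show "\<forall>\<^sub>F y in at x. slope \<phi> x y \<le> 2 * L + 1" using ev by eventually_elim (rule s2)
      fix p q :: real assume "p \<in> \<rat>" "q \<in> \<rat>" "1 < p" "p < q"
      then have "x \<notin> bad p q" using nx by auto
      then show "\<not> ((\<exists>\<^sub>F y in at x. slope \<phi> x y < p) \<and> (\<exists>\<^sub>F y in at x. slope \<phi> x y > q))"
        by (simp add: bad_def)
    qed simp
    then obtain l where "(slope \<phi> x \<longlongrightarrow> l) (at x)" by blast
    then have "(\<phi> has_field_derivative l) (at x)"
      unfolding has_field_derivative_iff slope_def .
    then have "((\<lambda>x. \<phi> x - (L + 1) * x) has_field_derivative l - (L + 1)) (at x)"
      by (auto intro!: derivative_eq_intros)
    then have "(g has_field_derivative l - (L + 1)) (at x)" by (simp add: \<phi>_def)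
    then show False using x by (auto simp: field_differentiable_def real_differentiable_def)
  qed
  moreover have "negligible (\<Union>p\<in>\<rat>. \<Union>q\<in>\<rat>. if 1 < p \<and> p < q then bad p q else {})"
    using neg countable_rat by (intro negligible_countable_Union) auto
  ultimately show ?thesis by (rule negligible_subset[rotated])
qed

theorem Rademacher_curve:
  fixes f :: "real \<Rightarrow> 'a::euclidean_space"
  assumes lip: "L-lipschitz_on UNIV f"
  shows "negligible {t. \<not> f differentiable (at t)}"
proof -
  have "negligible {t. \<not> (\<lambda>x. f x \<bullet> b) differentiable (at t)}" if "b \<in> Basis" for b
  proof (rule Rademacher_real)
    show "L-lipschitz_on UNIV (\<lambda>x. f x \<bullet> b)"
    proof (rule lipschitz_onI)
      fix x y
      have "dist (f x \<bullet> b) (f y \<bullet> b) \<le> dist (f x) (f y)"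
        using Basis_le_norm[OF that, of "f x - f y"] by (simp add: dist_norm inner_diff_left)
      also have "\<dots> \<le> L * dist x y" using lipschitz_onD[OF lip] by simp
      finally show "dist (f x \<bullet> b) (f y \<bullet> b) \<le> L * dist x y" .
    qed (rule lipschitz_on_nonneg[OF lip])
  qed
  then have "negligible (\<Union>b\<in>Basis. {t. \<not> (\<lambda>x. f x \<bullet> b) differentiable (at t)})"
    by (intro negligible_Union) auto
  moreover have "{t. \<not> f differentiable (at t)} = (\<Union>b\<in>Basis. {t. \<not> (\<lambda>x. f x \<bullet> b) differentiable (at t)})"
    by (subst differentiable_componentwise_within) blast
  ultimately show ?thesis by simp
qed

section \<open>Null sets of one-dimensional Hausdorff measure\<close>

text \<open>
  For null sets the restriction on the diameters of the covering sets is automatic: a total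
  diameter below \<open>\<delta>\<close> bounds every single diameter by \<open>\<delta>\<close>.
\<close>
lemma hausdorff1_eq_0_iff:
  fixes A :: "'a::metric_space set"
  shows "hausdorff1 A = 0 \<longleftrightarrow>
    (\<forall>e>0. \<exists>U. A \<subseteq> (\<Union>i::nat. U i) \<and> (\<forall>i. bounded (U i)) \<and> (\<Sum>i. ennreal (diameter (U i))) < ennreal e)"
    (is "?L \<longleftrightarrow> ?R")
proof
  assume ?L
  have "hausdorff1_pre 1 A \<le> hausdorff1 A"
    unfolding hausdorff1_def by (rule SUP_upper) simp
  with \<open>?L\<close> have pre0: "hausdorff1_pre 1 A = 0" by simp
  show ?R
  proof (intro allI impI)
    fix e :: real assume "e > 0"
    then have "hausdorff1_pre 1 A < ennreal e" using pre0 by simp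
    then obtain U :: "nat \<Rightarrow> 'a set" where "A \<subseteq> (\<Union>i. U i)" "\<forall>i. bounded (U i) \<and> diameter (U i) \<le> 1"
      "(\<Sum>i. ennreal (diameter (U i))) < ennreal e"
      unfolding hausdorff1_pre_def INF_less_iff by auto
    then show "\<exists>U. A \<subseteq> (\<Union>i::nat. U i) \<and> (\<forall>i. bounded (U i)) \<and> (\<Sum>i. ennreal (diameter (U i))) < ennreal e"
      by (intro exI[of _ U]) auto
  qed
next
  assume R: ?R
  have "hausdorff1_pre \<delta> A = 0" if "\<delta> > 0" for \<delta>
  proof -
    have "hausdorff1_pre \<delta> A \<le> 0 + ennreal e" if "e > 0" for e
    proof -
      obtain U where U: "A \<subseteq> (\<Union>i::nat. U i)" "\<And>i. bounded (U i)"
        "(\<Sum>i. ennreal (diameter (U i))) < ennreal (min e \<delta>)"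
        using R \<open>e > 0\<close> \<open>\<delta> > 0\<close> by (metis min_less_iff_conj)
      have "diameter (U i) \<le> \<delta>" for i
      proof -
        have "ennreal (diameter (U i)) \<le> (\<Sum>i. ennreal (diameter (U i)))"
          using sum_le_suminf[of "\<lambda>i. ennreal (diameter (U i))" "{i}"] by simp
        also note U(3)
        finally show ?thesis using diameter_ge_0[OF U(2)] by (simp add: ennreal_less_iff)
      qed
      then have "hausdorff1_pre \<delta> A \<le> (\<Sum>i. ennreal (diameter (U i)))"
        unfolding hausdorff1_pre_def using U by (intro INF_lower) auto
      also have "\<dots> \<le> ennreal (min e \<delta>)" using U(3) by simp
      also have "\<dots> \<le> ennreal e" by (intro ennreal_leI) simp
      finally show ?thesis by simp
    qed
    then have "hausdorff1_pre \<delta> A \<le> 0" by (rule ennreal_le_epsilon)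
    then show ?thesis by simp
  qed
  then show ?L unfolding hausdorff1_def by simp
qed

lemma hausdorff1_null_mono:
  fixes A B :: "'a::metric_space set"
  assumes "hausdorff1 B = 0" "A \<subseteq> B"
  shows "hausdorff1 A = 0"
  unfolding hausdorff1_eq_0_iff
proof (intro allI impI)
  fix e :: real assume "e > 0"
  then obtain U :: "nat \<Rightarrow> 'a set" where "B \<subseteq> (\<Union>i. U i)" "\<forall>i. bounded (U i)"
      "(\<Sum>i. ennreal (diameter (U i))) < ennreal e"
    using assms(1) unfolding hausdorff1_eq_0_iff by meson
  then show "\<exists>U. A \<subseteq> (\<Union>i::nat. U i) \<and> (\<forall>i. bounded (U i)) \<and> (\<Sum>i. ennreal (diameter (U i))) < ennreal e"
    using assms(2) by (intro exI[of _ U]) auto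
qed

lemma hausdorff1_null_UN:
  fixes A :: "nat \<Rightarrow> 'a::metric_space set"
  assumes "\<And>n. hausdorff1 (A n) = 0"
  shows "hausdorff1 (\<Union>n. A n) = 0"
  unfolding hausdorff1_eq_0_iff
proof (intro allI impI)
  fix e :: real assume "e > 0"
  define \<epsilon> where "\<epsilon> n = e / 2 * (1/2) ^ Suc n" for n :: nat
  have "\<epsilon> n > 0" for n using \<open>e > 0\<close> by (simp add: \<epsilon>_def)
  then have "\<exists>U. A n \<subseteq> (\<Union>i::nat. U i) \<and> (\<forall>i. bounded (U i)) \<and> (\<Sum>i. ennreal (diameter (U i))) < ennreal (\<epsilon> n)" for n
    using assms[of n] unfolding hausdorff1_eq_0_iff by blast
  then obtain U where U: "\<And>n. A n \<subseteq> (\<Union>i::nat. U n i)" "\<And>n i. bounded (U n i)"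
      "\<And>n. (\<Sum>i. ennreal (diameter (U n i))) < ennreal (\<epsilon> n)"
    by metis
  define V where "V k = (case prod_decode k of (n, i) \<Rightarrow> U n i)" for k
  have "(\<Sum>k. ennreal (diameter (V k))) = (\<Sum>n. \<Sum>i. ennreal (diameter (U n i)))"
    using suminf_ennreal_2dimen[of "\<lambda>n. \<Sum>i. ennreal (diameter (U n i))" "\<lambda>(n,i). ennreal (diameter (U n i))"]
    by (simp add: V_def case_prod_beta)
  also have "\<dots> \<le> (\<Sum>n. ennreal (\<epsilon> n))"
    using U(3) by (intro suminf_le) (auto simp: less_imp_le)
  also have "\<dots> = ennreal (e / 2)"
  proof (rule suminf_ennreal_eq)
    show "0 \<le> \<epsilon> n" for n using \<open>\<epsilon> n > 0\<close> by simp
    show "\<epsilon> sums (e / 2)" unfolding \<epsilon>_def using sums_mult[OF power_half_series, of "e / 2"] by simp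
  qed
  also have "\<dots> < ennreal e" using \<open>e > 0\<close> by (intro ennreal_lessI) auto
  finally have "(\<Sum>k. ennreal (diameter (V k))) < ennreal e" .
  moreover have "bounded (V k)" for k using U(2) by (simp add: V_def case_prod_beta)
  moreover have "(\<Union>n. A n) \<subseteq> (\<Union>k. V k)"
  proof
    fix x assume "x \<in> (\<Union>n. A n)"
    then obtain n i where "x \<in> U n i" using U(1) by blast
    then have "x \<in> V (prod_encode (n, i))" by (simp add: V_def)
    then show "x \<in> (\<Union>k. V k)" by blast
  qed
  ultimately show "\<exists>U. (\<Union>n. A n) \<subseteq> (\<Union>i::nat. U i) \<and> (\<forall>i. bounded (U i)) \<and> (\<Sum>i. ennreal (diameter (U i))) < ennreal e"
    by blast
qed

lemma hausdorff1_null_Un: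
  assumes "hausdorff1 A = 0" "hausdorff1 B = 0"
  shows "hausdorff1 (A \<union> B) = 0"
proof -
  have "hausdorff1 (\<Union>n::nat. if n = 0 then A else B) = 0"
    using assms by (intro hausdorff1_null_UN) auto
  then show ?thesis by (rule hausdorff1_null_mono) auto
qed

text \<open>
  The common covering argument behind the next two results. The \<open>5r\<close>-covering lemma selects
  disjoint balls whose fivefold enlargements cover \<open>S\<close>; the enlargements are what gets mapped,
  while the total size is controlled by the disjoint balls inside \<open>U\<close>. No null set is left over,
  in contrast to Vitali's theorem.
\<close>
lemma image_cover_diameter_sum:
  fixes f :: "real \<Rightarrow> 'b::real_normed_vector"
  assumes "open U" and m: "emeasure lebesgue U \<le> ennreal m" and "c \<ge> 0"
    and loc: "\<And>x. x \<in> S \<Longrightarrow> \<exists>\<rho>>0. ball x \<rho> \<subseteq> U \<and>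
            (\<forall>s\<in>ball x (5 * \<rho>). \<forall>t\<in>ball x (5 * \<rho>). dist (f s) (f t) \<le> c * \<rho>)"
  obtains V :: "nat \<Rightarrow> 'b set" where "f ` S \<subseteq> (\<Union>i. V i)" "\<And>i. bounded (V i)"
    "(\<Sum>i. ennreal (diameter (V i))) \<le> ennreal c * ennreal m"
proof -
  obtain \<rho> where \<rho>: "\<And>x. x \<in> S \<Longrightarrow> \<rho> x > 0" "\<And>x. x \<in> S \<Longrightarrow> ball x (\<rho> x) \<subseteq> U"
    and d: "\<And>x s t. x \<in> S \<Longrightarrow> s \<in> ball x (5 * \<rho> x) \<Longrightarrow> t \<in> ball x (5 * \<rho> x) \<Longrightarrow> dist (f s) (f t) \<le> c * \<rho> x"
    using loc by metis
  have mball: "ennreal (\<rho> x) \<le> emeasure lebesgue (ball x (\<rho> x))" if "x \<in> S" for x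
    using \<rho>(1)[OF that] by (simp add: ball_eq_greaterThanLessThan ennreal_leI)
  have "\<rho> x \<le> m" if "x \<in> S" for x
  proof -
    have "ennreal (\<rho> x) \<le> emeasure lebesgue U"
      using mball[OF that] emeasure_mono[OF \<rho>(2)[OF that], of lebesgue] \<open>open U\<close>
      by (meson borel_open lborelD order_trans sets_completionI_sets)
    then have "ennreal (\<rho> x) \<le> ennreal m" using m by (rule order_trans)
    then show ?thesis using \<rho>(1)[OF that] by (metis ennreal_le_iff2 less_le_not_le)
  qed
  then have rm: "0 < \<rho> x \<and> \<rho> x \<le> m" if "x \<in> S" for x using \<rho>(1) that by blast
  obtain C where C: "countable C" "C \<subseteq> S"
     "pairwise (\<lambda>i j. disjnt (ball i (\<rho> i)) (ball j (\<rho> j))) C"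
     "S \<subseteq> (\<Union>i\<in>C. ball i (5 * \<rho> i))"
  proof (rule Vitali_covering_lemma_balls[of S "\<lambda>x. x" \<rho> S m])
    show "S \<subseteq> (\<Union>i\<in>S. ball i (\<rho> i))" using \<rho>(1) centre_in_ball by blast
  qed (use rm in auto)
  define B where "B = (\<lambda>x. ball x (\<rho> x))"
  have "disjoint_family_on B C"
    using C(3) unfolding disjoint_family_on_def pairwise_def disjnt_def B_def by blast
  then obtain I h where h: "bij_betw h (I::nat set) C"
    and sum: "(\<Sum>n. if n \<in> I then emeasure lebesgue (B (h n)) else 0) \<le> emeasure lebesgue U"
  proof (rule disjoint_family_nat_sequence[OF C(1), of B U])
    show "B i \<in> sets lebesgue" for i by (simp add: B_def)
    show "B i \<subseteq> U" if "i \<in> C" for i using that C(2) \<rho>(2) by (auto simp: B_def)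
    show "U \<in> sets lebesgue" using \<open>open U\<close> by auto
  qed
  have hS: "h n \<in> S" if "n \<in> I" for n using h that C(2) by (auto simp: bij_betw_def)
  define V where "V n = (if n \<in> I then f ` ball (h n) (5 * \<rho> (h n)) else {})" for n
  have Vd: "dist y z \<le> c * \<rho> (h n)" if "y \<in> V n" "z \<in> V n" "n \<in> I" for y z n
    using that d[OF hS[OF that(3)]] by (auto simp: V_def)
  show ?thesis
  proof (rule that[of V])
    show "f ` S \<subseteq> (\<Union>i. V i)"
    proof -
      have "C = h ` I" using h by (auto simp: bij_betw_def)
      then have "S \<subseteq> (\<Union>n\<in>I. ball (h n) (5 * \<rho> (h n)))" using C(4) by simp
      then show ?thesis by (force simp: V_def)
    qed
    show "bounded (V n)" for n
    proof (cases "n \<in> I")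
      case True
      then show ?thesis using Vd[of _ n] unfolding bounded_two_points by blast
    qed (simp add: V_def)
    have "(\<Sum>n. ennreal (diameter (V n)))
        \<le> (\<Sum>n. ennreal c * (if n \<in> I then emeasure lebesgue (B (h n)) else 0))"
    proof (rule suminf_le)
      fix n
      show "ennreal (diameter (V n)) \<le> ennreal c * (if n \<in> I then emeasure lebesgue (B (h n)) else 0)"
      proof (cases "n \<in> I")
        case True
        have "diameter (V n) \<le> c * \<rho> (h n)"
          using Vd[of _ n] True \<open>c \<ge> 0\<close> \<rho>(1)[OF hS[OF True]]
          by (intro diameter_le) (auto simp: dist_norm)
        then have "ennreal (diameter (V n)) \<le> ennreal c * ennreal (\<rho> (h n))"
          using \<open>c \<ge> 0\<close> \<rho>(1)[OF hS[OF True]] by (subst ennreal_mult[symmetric]) (auto intro: ennreal_leI)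
        also have "\<dots> \<le> ennreal c * emeasure lebesgue (B (h n))"
          using mball[OF hS[OF True]] unfolding B_def by (rule mult_left_mono) simp
        finally show ?thesis using True by simp
      qed (simp add: V_def)
    qed auto
    also have "\<dots> = ennreal c * (\<Sum>n. if n \<in> I then emeasure lebesgue (B (h n)) else 0)" by simp
    also have "\<dots> \<le> ennreal c * ennreal m"
      using sum m by (intro mult_left_mono) auto
    finally show "(\<Sum>i. ennreal (diameter (V i))) \<le> ennreal c * ennreal m" .
  qed
qed

lemma hausdorff1_image_negligible:
  fixes f :: "real \<Rightarrow> 'b::real_normed_vector"
  assumes lip: "L-lipschitz_on UNIV f" and "negligible Z"
  shows "hausdorff1 (f ` Z) = 0"
  unfolding hausdorff1_eq_0_iff
proof (intro allI impI)
  fix e :: real assume "e > 0"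
  have "L \<ge> 0" using lip by (rule lipschitz_on_nonneg)
  define m where "m = e / (2 * (10 * L + 1))"
  have "m > 0" using \<open>e > 0\<close> \<open>L \<ge> 0\<close> by (simp add: m_def)
  have Z: "Z \<in> null_sets lebesgue" using assms(2) by (simp add: negligible_iff_null_sets)
  obtain U where U: "open U" "Z \<subseteq> U" "U - Z \<in> lmeasurable" "emeasure lebesgue (U - Z) < ennreal m"
    using sets_lebesgue_outer_open[of Z m] Z \<open>m > 0\<close> by (metis null_setsD2)
  have "emeasure lebesgue U = emeasure lebesgue (U - Z)"
    using emeasure_Diff_null_set[OF Z, of U] U(1) by simp
  then have mU: "emeasure lebesgue U \<le> ennreal m" using U(4) by simp
  obtain V :: "nat \<Rightarrow> 'b set" where V: "f ` Z \<subseteq> (\<Union>i. V i)" "\<And>i. bounded (V i)"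
    "(\<Sum>i. ennreal (diameter (V i))) \<le> ennreal (10 * L) * ennreal m"
  proof (rule image_cover_diameter_sum[OF U(1) mU, of "10 * L" Z f])
    fix x assume "x \<in> Z"
    then obtain \<rho> where \<rho>: "\<rho> > 0" "ball x \<rho> \<subseteq> U" using U by (meson openE subsetD)
    have "dist (f s) (f t) \<le> 10 * L * \<rho>" if "s \<in> ball x (5 * \<rho>)" "t \<in> ball x (5 * \<rho>)" for s t
    proof -
      have "dist s t \<le> 10 * \<rho>" using that dist_triangle2[of s t x] by (simp add: dist_commute)
      then have "L * dist s t \<le> L * (10 * \<rho>)" using \<open>L \<ge> 0\<close> by (rule mult_left_mono)
      then show ?thesis using lipschitz_onD[OF lip, of s t] by simp
    qed
    then show "\<exists>\<rho>>0. ball x \<rho> \<subseteq> U \<and>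
        (\<forall>s\<in>ball x (5 * \<rho>). \<forall>t\<in>ball x (5 * \<rho>). dist (f s) (f t) \<le> 10 * L * \<rho>)"
      using \<rho> by blast
  qed (use \<open>L \<ge> 0\<close> in auto)
  have "ennreal (10 * L) * ennreal m = ennreal (10 * L * m)"
    using \<open>L \<ge> 0\<close> \<open>m > 0\<close> by (simp add: ennreal_mult)
  moreover have "10 * L * m < e" using \<open>e > 0\<close> \<open>L \<ge> 0\<close> by (simp add: m_def divide_simps)
  ultimately have "(\<Sum>i. ennreal (diameter (V i))) < ennreal e"
    using V(3) \<open>e > 0\<close> by (metis ennreal_lessI order_le_less_trans)
  then show "\<exists>U. f ` Z \<subseteq> (\<Union>i::nat. U i) \<and> (\<forall>i. bounded (U i)) \<and> (\<Sum>i. ennreal (diameter (U i))) < ennreal e"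
    using V by blast
qed

text \<open>
  Sard's theorem for curves. Near a zero of the derivative \<open>f\<close> contracts by an arbitrarily small
  factor \<open>c\<close>, so the image of \<open>S\<close> is covered with total diameter at most \<open>c\<close> times the length of an
  interval containing \<open>S\<close>.
\<close>
lemma hausdorff1_critical_values_bounded:
  fixes f :: "real \<Rightarrow> 'b::real_normed_vector"
  assumes crit: "\<And>x. x \<in> S \<Longrightarrow> (f has_vector_derivative 0) (at x)" and "S \<subseteq> ball 0 N"
  shows "hausdorff1 (f ` S) = 0"
  unfolding hausdorff1_eq_0_iff
proof (intro allI impI)
  fix e :: real assume "e > 0"
  define m where "m = 2 * \<bar>N\<bar> + 1"
  have "m > 0" by (simp add: m_def)
  define c where "c = e / (2 * m)"
  have "c > 0" using \<open>e > 0\<close> \<open>m > 0\<close> by (simp add: c_def)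
  have mU: "emeasure lebesgue (ball 0 N :: real set) \<le> ennreal m"
    by (cases "N \<ge> 0") (auto simp: m_def ball_eq_greaterThanLessThan ball_empty intro!: ennreal_leI)
  obtain V :: "nat \<Rightarrow> 'b set" where V: "f ` S \<subseteq> (\<Union>i. V i)" "\<And>i. bounded (V i)"
    "(\<Sum>i. ennreal (diameter (V i))) \<le> ennreal c * ennreal m"
  proof (rule image_cover_diameter_sum[OF open_ball mU, of c S f])
    fix x assume x: "x \<in> S"
    obtain k where k: "k > 0" "ball x k \<subseteq> ball 0 N" using x assms(2) by (meson openE open_ball subsetD)
    obtain d where d: "d > 0" "\<And>y. norm (y - x) < d \<Longrightarrow> norm (f y - f x) \<le> c / 10 * norm (y - x)"
      using crit[OF x] \<open>c > 0\<close> unfolding has_vector_derivative_def has_derivative_at_alt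
      by (force dest: spec[of _ "c / 10"])
    define \<rho> where "\<rho> = min k (d / 5)"
    have "\<rho> > 0" using k d by (simp add: \<rho>_def)
    have *: "dist (f s) (f x) \<le> c / 10 * (5 * \<rho>)" if "s \<in> ball x (5 * \<rho>)" for s
    proof -
      have "norm (s - x) < 5 * \<rho>" using that by (simp add: dist_norm norm_minus_commute)
      moreover have "5 * \<rho> \<le> d" by (simp add: \<rho>_def)
      ultimately have "norm (f s - f x) \<le> c / 10 * norm (s - x)" using d(2) by simp
      also have "\<dots> \<le> c / 10 * (5 * \<rho>)"
        using \<open>norm (s - x) < 5 * \<rho>\<close> \<open>c > 0\<close> by (intro mult_left_mono) auto
      finally show ?thesis by (simp add: dist_norm)
    qed
    have "dist (f s) (f t) \<le> c * \<rho>" if "s \<in> ball x (5 * \<rho>)" "t \<in> ball x (5 * \<rho>)" for s t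
      using *[OF that(1)] *[OF that(2)] dist_triangle2[of "f s" "f t" "f x"]
      by (simp add: mult.commute)
    moreover have "ball x \<rho> \<subseteq> ball 0 N" using k by (auto simp: \<rho>_def)
    ultimately show "\<exists>\<rho>>0. ball x \<rho> \<subseteq> ball 0 N \<and>
        (\<forall>s\<in>ball x (5 * \<rho>). \<forall>t\<in>ball x (5 * \<rho>). dist (f s) (f t) \<le> c * \<rho>)"
      using \<open>\<rho> > 0\<close> by blast
  qed (use \<open>c > 0\<close> in auto)
  have "ennreal c * ennreal m = ennreal (e / 2)"
    using \<open>c > 0\<close> \<open>m > 0\<close> by (simp add: ennreal_mult[symmetric] c_def)
  also have "\<dots> < ennreal e" using \<open>e > 0\<close> by (intro ennreal_lessI) auto
  finally have "(\<Sum>i. ennreal (diameter (V i))) < ennreal e" using V(3) by (rule order_le_less_trans[rotated])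
  then show "\<exists>U. f ` S \<subseteq> (\<Union>i::nat. U i) \<and> (\<forall>i. bounded (U i)) \<and> (\<Sum>i. ennreal (diameter (U i))) < ennreal e"
    using V by blast
qed

lemma hausdorff1_critical_values:
  fixes f :: "real \<Rightarrow> 'b::real_normed_vector"
  assumes crit: "\<And>x. x \<in> S \<Longrightarrow> (f has_vector_derivative 0) (at x)"
  shows "hausdorff1 (f ` S) = 0"
proof -
  have "hausdorff1 (\<Union>n::nat. f ` (S \<inter> ball 0 (real n))) = 0"
    using crit by (intro hausdorff1_null_UN hausdorff1_critical_values_bounded) auto
  then show ?thesis
  proof (rule hausdorff1_null_mono)
    show "f ` S \<subseteq> (\<Union>n::nat. f ` (S \<inter> ball 0 (real n)))"
    proof
      fix y assume "y \<in> f ` S"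
      then obtain x where x: "x \<in> S" "y = f x" by auto
      obtain n :: nat where "\<bar>x\<bar> < real n" using reals_Archimedean2 by blast
      then have "x \<in> S \<inter> ball 0 (real n)" using x by simp
      then show "y \<in> (\<Union>n::nat. f ` (S \<inter> ball 0 (real n)))" using x by blast
    qed
  qed
qed

section \<open>Circles centred on a set of length zero\<close>

lemma emeasure_annulus:
  fixes v :: "real^2"
  assumes "0 \<le> k" "k \<le> R"
  shows "emeasure lebesgue (cball v (R + k) - ball v (R - k)) = ennreal (4 * pi * R * k)"
proof -
  have "emeasure lebesgue (cball v (R + k) - ball v (R - k))
      = emeasure lebesgue (cball v (R + k)) - emeasure lebesgue (ball v (R - k))"
    using assms emeasure_bounded_finite[of "ball v (R - k)"] by (intro emeasure_Diff) auto
  also have "emeasure lebesgue (cball v (R + k)) = ennreal ((R + k)\<^sup>2 * pi)"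
    using assms by (simp add: emeasure_cball unit_ball_vol_2 mult.commute)
  also have "emeasure lebesgue (ball v (R - k)) = ennreal ((R - k)\<^sup>2 * pi)"
    using assms by (simp add: emeasure_ball unit_ball_vol_2 mult.commute)
  also have "ennreal ((R + k)\<^sup>2 * pi) - ennreal ((R - k)\<^sup>2 * pi) = ennreal ((R + k)\<^sup>2 * pi - (R - k)\<^sup>2 * pi)"
    by (intro ennreal_minus) simp
  also have "(R + k)\<^sup>2 * pi - (R - k)\<^sup>2 * pi = 4 * pi * R * k"
    by (simp add: power2_eq_square algebra_simps)
  finally show ?thesis .
qed

text \<open>
  If the centres range over a set of diameter \<open>d\<close>, then centre and radius vary by at most \<open>d\<close> and
  \<open>L d\<close>, so all the circles lie in one annulus of half-width \<open>(1 + L) d\<close>, whose area is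
  proportional to \<open>d\<close>.
\<close>
lemma negligible_circles_over_null:
  fixes r :: "real^2 \<Rightarrow> real"
  assumes null: "hausdorff1 N = 0" and lip: "L-lipschitz_on UNIV r"
    and r: "\<And>z. a \<le> r z" "\<And>z. r z \<le> b" and "0 < a"
  shows "negligible (\<Union>v\<in>N. sphere v (r v))"
  unfolding negligible_outer_le
proof (intro allI impI)
  fix e :: real assume "e > 0"
  have "L \<ge> 0" using lip by (rule lipschitz_on_nonneg)
  have "b > 0" using r[of 0] \<open>0 < a\<close> by linarith
  define c where "c = 4 * pi * b * (1 + L)"
  have "c > 0" using \<open>b > 0\<close> \<open>L \<ge> 0\<close> by (simp add: c_def)
  \<comment> \<open>The second bound keeps the inner radius of every annulus nonnegative.\<close>
  define \<epsilon> where "\<epsilon> = min (e / c) (a / (1 + L))"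
  have "\<epsilon> > 0" using \<open>e > 0\<close> \<open>c > 0\<close> \<open>0 < a\<close> \<open>L \<ge> 0\<close> by (simp add: \<epsilon>_def)
  then obtain U :: "nat \<Rightarrow> (real^2) set" where U: "N \<subseteq> (\<Union>i. U i)" "\<And>i. bounded (U i)"
      "(\<Sum>i. ennreal (diameter (U i))) < ennreal \<epsilon>"
    using null unfolding hausdorff1_eq_0_iff by meson
  define d where "d i = diameter (U i)" for i
  have d0: "d i \<ge> 0" for i unfolding d_def by (rule diameter_ge_0[OF U(2)])
  have dle: "(1 + L) * d i \<le> a" for i
  proof -
    have "ennreal (d i) \<le> (\<Sum>i. ennreal (diameter (U i)))"
      using sum_le_suminf[of "\<lambda>i. ennreal (diameter (U i))" "{i}"] by (simp add: d_def)
    also note U(3)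
    finally have "d i < a / (1 + L)" using d0 by (simp add: ennreal_less_iff \<epsilon>_def)
    then show ?thesis using \<open>L \<ge> 0\<close> by (simp add: field_simps)
  qed
  \<comment> \<open>An arbitrary point if \<open>U i\<close> is empty; its annulus has half-width zero then.\<close>
  define x where "x i = (SOME v. v \<in> U i)" for i
  define k where "k i = (1 + L) * d i" for i
  define T where "T i = cball (x i) (r (x i) + k i) - ball (x i) (r (x i) - k i)" for i
  have eT: "emeasure lebesgue (T i) \<le> ennreal c * ennreal (d i)" for i
  proof -
    have "0 \<le> k i" "k i \<le> r (x i)"
      using d0 dle[of i] \<open>L \<ge> 0\<close> r(1)[of "x i"] by (auto simp: k_def)
    then have "emeasure lebesgue (T i) = ennreal (4 * pi * r (x i) * k i)"
      unfolding T_def by (rule emeasure_annulus)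
    also have "\<dots> \<le> ennreal (4 * pi * b * k i)"
      using r(2) \<open>0 \<le> k i\<close> by (intro ennreal_leI mult_right_mono mult_left_mono) auto
    also have "4 * pi * b * k i = c * d i" by (simp add: c_def k_def)
    finally show ?thesis using \<open>c > 0\<close> d0 by (simp add: ennreal_mult)
  qed
  have Ts: "T i \<in> sets lebesgue" for i by (simp add: T_def)
  have "emeasure lebesgue (\<Union>i. T i) \<le> (\<Sum>i. emeasure lebesgue (T i))"
    using Ts by (intro emeasure_subadditive_countably) auto
  also have "\<dots> \<le> (\<Sum>i. ennreal c * ennreal (d i))"
    using eT by (intro suminf_le) auto
  also have "\<dots> = ennreal c * (\<Sum>i. ennreal (d i))" by simp
  also have "\<dots> \<le> ennreal c * ennreal (e / c)"
  proof (rule mult_left_mono)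
    have "(\<Sum>i. ennreal (d i)) \<le> ennreal \<epsilon>" using U(3) by (simp add: d_def)
    also have "\<dots> \<le> ennreal (e / c)" by (intro ennreal_leI) (simp add: \<epsilon>_def)
    finally show "(\<Sum>i. ennreal (d i)) \<le> ennreal (e / c)" .
  qed simp
  also have "\<dots> = ennreal e" using \<open>c > 0\<close> \<open>e > 0\<close> by (simp add: ennreal_mult[symmetric])
  finally have em: "emeasure lebesgue (\<Union>i. T i) \<le> ennreal e" .
  show "\<exists>T. (\<Union>v\<in>N. sphere v (r v)) \<subseteq> T \<and> T \<in> lmeasurable \<and> measure lebesgue T \<le> e"
  proof (intro exI conjI)
    show "(\<Union>i. T i) \<in> lmeasurable"
      using em Ts by (intro fmeasurableI) (auto intro: order_le_less_trans)
    show "measure lebesgue (\<Union>i. T i) \<le> e"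
      using em \<open>e > 0\<close> unfolding measure_def by (simp add: enn2real_leI)
    show "(\<Union>v\<in>N. sphere v (r v)) \<subseteq> (\<Union>i. T i)"
    proof
      fix w assume "w \<in> (\<Union>v\<in>N. sphere v (r v))"
      then obtain v where v: "v \<in> N" "dist v w = r v" by auto
      then obtain i where i: "v \<in> U i" using U(1) by blast
      then have "x i \<in> U i" unfolding x_def by (rule someI)
      then have dv: "dist (x i) v \<le> d i"
        using diameter_bounded_bound[OF U(2)] i by (simp add: d_def)
      have "\<bar>r (x i) - r v\<bar> \<le> L * dist (x i) v"
        using lipschitz_onD[OF lip, of "x i" v] by (simp add: dist_real_def)
      also have "\<dots> \<le> L * d i" using dv \<open>L \<ge> 0\<close> by (rule mult_left_mono)
      finally have rv: "\<bar>r (x i) - r v\<bar> \<le> L * d i" .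
      have k: "k i = d i + L * d i" by (simp add: k_def algebra_simps)
      have "dist (x i) w \<le> dist (x i) v + dist v w" by (rule dist_triangle)
      then have "dist (x i) w \<le> r (x i) + k i" using dv rv v(2) k by linarith
      moreover have "dist v w \<le> dist (x i) v + dist (x i) w"
        using dist_triangle[of v w "x i"] by (simp add: dist_commute)
      then have "r (x i) - k i \<le> dist (x i) w" using dv rv v(2) k by linarith
      ultimately have "w \<in> T i" by (simp add: T_def)
      then show "w \<in> (\<Union>i. T i)" by blast
    qed
  qed
qed

section \<open>An admissible radius function is Lipschitz\<close>

lemma negligible_iff_AE: "negligible {x. \<not> P x} \<longleftrightarrow> (AE x in lebesgue. P x)"
proof
  assume "negligible {x. \<not> P x}"
  then show "AE x in lebesgue. P x"
    unfolding negligible_iff_null_sets by (auto elim: AE_I')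
next
  assume "AE x in lebesgue. P x"
  then obtain N where "N \<in> null_sets lebesgue" "{x. \<not> P x} \<subseteq> N"
    unfolding eventually_ae_filter by auto
  then show "negligible {x. \<not> P x}"
    using negligible_iff_null_sets negligible_subset by blast
qed

lemma negligible_sections:
  fixes N :: "('a::euclidean_space \<times> 'b::euclidean_space) set"
  assumes "negligible N"
  shows "negligible {x. \<not> negligible {y. (x, y) \<in> N}}"
proof -
  have "AE z in lebesgue. z \<notin> N"
    using assms unfolding negligible_iff_AE[symmetric] by simp
  then have "AE z in (lborel \<Otimes>\<^sub>M lborel). z \<notin> N"
    unfolding AE_completion_iff lborel_prod .
  then have "AE x in lborel. AE y in lborel. (x, y) \<notin> N"
    by (rule lborel_pair.AE_pair)
  then have "AE x in lebesgue. AE y in lebesgue. (x, y) \<notin> N"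
    unfolding AE_completion_iff .
  then show ?thesis
    unfolding negligible_iff_AE[symmetric] by simp
qed

text \<open>
  The Henstock--Kurzweil integral recovers a function from its derivative whenever the latter exists
  everywhere, and its value does not depend on the integrand on a null set.
\<close>
lemma lipschitz_of_AE_bounded_derivative:
  fixes g g' :: "real \<Rightarrow> real"
  assumes deriv: "\<And>x. (g has_real_derivative g' x) (at x)"
    and neg: "negligible {x. \<not> \<bar>g' x\<bar> \<le> M}" and "M \<ge> 0"
  shows "\<bar>g b - g a\<bar> \<le> M * \<bar>b - a\<bar>"
proof -
  have *: "\<bar>g b - g a\<bar> \<le> M * (b - a)" if "a \<le> b" for a b
  proof -
    have "(g' has_integral (g b - g a)) {a..b}"
      using that deriv
      by (intro fundamental_theorem_of_calculus)
         (auto simp: has_real_derivative_iff_has_vector_derivative[symmetric] intro: has_field_derivative_at_within)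
    then have "((\<lambda>x. if \<bar>g' x\<bar> \<le> M then g' x else 0) has_integral (g b - g a)) {a..b}"
      by (rule has_integral_spike[OF neg, rotated]) auto
    then have "norm (g b - g a) \<le> M * measure lborel (cbox a b)"
      by (intro has_integral_bound[OF \<open>M \<ge> 0\<close>]) (use \<open>M \<ge> 0\<close> in auto)
    then show ?thesis using that by simp
  qed
  show ?thesis
    using *[of a b] *[of b a] by (cases "a \<le> b") (auto simp: abs_minus_commute)
qed

lemma has_partial_derivative:
  fixes r :: "real^'n::finite \<Rightarrow> real"
  assumes "r differentiable (at (w + s *\<^sub>R axis i 1))"
  shows "((\<lambda>s. r (w + s *\<^sub>R axis i 1)) has_real_derivative partial_deriv i r (w + s *\<^sub>R axis i 1)) (at s)"
proof -
  obtain D where D: "(r has_derivative D) (at (w + s *\<^sub>R axis i 1))"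
    using assms by (auto simp: differentiable_def)
  then have lin: "D (t *\<^sub>R axis i 1) = D (axis i 1) * t" for t
    using linear_scale[OF has_derivative_linear[OF D], of t "axis i 1"] by simp
  have "((\<lambda>t. r ((w + s *\<^sub>R axis i 1) + t *\<^sub>R axis i 1)) has_derivative (\<lambda>t. D (t *\<^sub>R axis i 1))) (at 0)"
    by (rule has_derivative_compose[of "\<lambda>t. (w + s *\<^sub>R axis i 1) + t *\<^sub>R axis i 1" "\<lambda>t. t *\<^sub>R axis i 1" 0 UNIV r D])
       (auto intro!: derivative_eq_intros D)
  then have 1: "((\<lambda>t. r ((w + s *\<^sub>R axis i 1) + t *\<^sub>R axis i 1)) has_real_derivative D (axis i 1)) (at 0)"
    unfolding has_field_derivative_def lin .
  then have pd: "partial_deriv i r (w + s *\<^sub>R axis i 1) = D (axis i 1)"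
    unfolding partial_deriv_def by (rule DERIV_imp_deriv)
  have "((\<lambda>s. r (w + s *\<^sub>R axis i 1)) has_derivative (\<lambda>t. D (t *\<^sub>R axis i 1))) (at s)"
    by (rule has_derivative_compose[of "\<lambda>t. w + t *\<^sub>R axis i 1" "\<lambda>t. t *\<^sub>R axis i 1" s UNIV r D])
       (auto intro!: derivative_eq_intros D)
  then show ?thesis
    unfolding has_field_derivative_def lin pd .
qed

text \<open>
  By Fubini the bound on the gradient holds almost everywhere on almost every line parallel to
  axis \<open>i\<close>, so \<open>r\<close> is \<open>M\<close>-Lipschitz on these lines. They are dense, and \<open>r\<close> is continuous, so the
  same holds on every such line.
\<close>
lemma coordinate_lipschitz:
  fixes r :: "real^2 \<Rightarrow> real"
  assumes diff: "\<And>z. r differentiable (at z)"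
    and ae: "AE z in lebesgue. norm (gradient r z) \<le> M" and "M \<ge> 0"
    and "i \<noteq> j" and zw: "z $ j = w $ j"
  shows "\<bar>r z - r w\<bar> \<le> M * \<bar>z $ i - w $ i\<bar>"
proof -
  define P where "P t s = t *\<^sub>R axis j (1::real) + s *\<^sub>R axis i 1" for t s :: real
  have ij: "k = i \<or> k = j" for k :: 2 using \<open>i \<noteq> j\<close> exhaust_2 by metis
  have P: "P (y $ j) (y $ i) = y" for y
    unfolding vec_eq_iff P_def using \<open>i \<noteq> j\<close> ij by (auto simp: axis_def)
  have Pc: "P t s $ j = t" "P t s $ i = s" for t s
    using \<open>i \<noteq> j\<close> by (auto simp: P_def axis_def)
  define B where "B = {z. \<not> norm (gradient r z) \<le> M}"
  define Q where "Q z = (z $ j, z $ i)" for z :: "real^2"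
  have "negligible B" using ae unfolding B_def negligible_iff_AE .
  moreover have "linear Q" by (rule linearI) (auto simp: Q_def)
  ultimately have "negligible (Q ` B)"
    by (intro negligible_differentiable_image_negligible linear_imp_differentiable_on) auto
  moreover have "(t, s) \<in> Q ` B" if "P t s \<in> B" for t s
    using that by (intro image_eqI[of _ _ "P t s"]) (auto simp: Q_def Pc)
  then have "{(t, s). P t s \<in> B} \<subseteq> Q ` B" by auto
  ultimately have neg: "negligible {t. \<not> negligible {s. (t, s) \<in> {(t, s). P t s \<in> B}}}"
    by (intro negligible_sections) (rule negligible_subset)
  have line: "\<bar>r (P t b) - r (P t a)\<bar> \<le> M * \<bar>b - a\<bar>" if "negligible {s. P t s \<in> B}" for t a b
  proof (rule lipschitz_of_AE_bounded_derivative[OF _ _ \<open>M \<ge> 0\<close>])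
    show "((\<lambda>s. r (P t s)) has_real_derivative partial_deriv i r (P t s)) (at s)" for s
      unfolding P_def by (rule has_partial_derivative) (rule diff)
    have "\<bar>partial_deriv i r y\<bar> \<le> norm (gradient r y)" for y
      using component_le_norm_cart[of "gradient r y" i] by (simp add: gradient_def)
    then have "{s. \<not> \<bar>partial_deriv i r (P t s)\<bar> \<le> M} \<subseteq> {s. P t s \<in> B}"
      unfolding B_def by (auto intro: order_trans)
    then show "negligible {s. \<not> \<bar>partial_deriv i r (P t s)\<bar> \<le> M}"
      using that negligible_subset by blast
  qed
  have "continuous_on UNIV r"
    using diff by (meson continuous_at_imp_continuous_on differentiable_imp_continuous_within)
  then have cont: "continuous_on UNIV (\<lambda>t. r (P t s))" for s
    by (rule continuous_on_compose2) (auto simp: P_def intro!: continuous_intros)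
  \<comment> \<open>The lines on which the estimate fails form an open set that is null, hence empty.\<close>
  let ?O = "{t. M * \<bar>z $ i - w $ i\<bar> < \<bar>r (P t (z $ i)) - r (P t (w $ i))\<bar>}"
  have "open ?O" by (intro open_Collect_less continuous_intros cont)
  moreover have "?O \<subseteq> {t. \<not> negligible {s. (t, s) \<in> {(t, s). P t s \<in> B}}}"
    using line by (auto simp: not_le[symmetric])
  then have "negligible ?O" using neg negligible_subset by blast
  ultimately have "?O = {}" using open_not_negligible by blast
  then have "z $ j \<notin> ?O" by blast
  then show ?thesis using P[of z] P[of w] zw by (auto simp: not_less)
qed

lemma admissible_radius_lipschitz:
  assumes "admissible_radius r"
  obtains L where "L-lipschitz_on UNIV r"
proof -
  obtain M0 where diff: "\<And>z. r differentiable (at z)" and M0: "AE z in lebesgue. norm (gradient r z) \<le> M0"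
    using assms unfolding admissible_radius_def by auto
  define M where "M = \<bar>M0\<bar>"
  have M: "AE z in lebesgue. norm (gradient r z) \<le> M" "M \<ge> 0"
    using M0 by (auto simp: M_def)
  have "(2 * M)-lipschitz_on UNIV r"
  proof (rule lipschitz_onI)
    fix z w :: "real^2"
    \<comment> \<open>The corner joining \<open>z\<close> to \<open>w\<close> by segments parallel to the axes.\<close>
    define y :: "real^2" where "y = (\<chi> k. if k = 1 then z $ 1 else w $ 2)"
    have "\<bar>r z - r y\<bar> \<le> M * \<bar>z $ 2 - w $ 2\<bar>"
      using coordinate_lipschitz[OF diff M, of 2 1 z y] by (simp add: y_def)
    moreover have "\<bar>r y - r w\<bar> \<le> M * \<bar>z $ 1 - w $ 1\<bar>"
      using coordinate_lipschitz[OF diff M, of 1 2 y w] by (simp add: y_def)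
    moreover have "M * \<bar>z $ k - w $ k\<bar> \<le> M * dist z w" for k
      using component_le_norm_cart[of "z - w" k] \<open>M \<ge> 0\<close>
      by (intro mult_left_mono) (auto simp: dist_norm)
    from this[of 1] this[of 2] calculation
    show "dist (r z) (r w) \<le> 2 * M * dist z w"
      unfolding dist_real_def by linarith
  qed (use M in simp)
  then show ?thesis using that by blast
qed

section \<open>Maps with injective derivative reflect null sets\<close>

text \<open>
  \<open>S\<close> is a countable union of sets \<open>T n\<close> on which the expansion constants are uniform. On a small
  piece of \<open>T n\<close> the map \<open>f\<close> is injective with Lipschitz inverse, and Lipschitz maps preserve null
  sets.
\<close>
lemma negligible_of_negligible_image:
  fixes f :: "'a::euclidean_space \<Rightarrow> 'b::euclidean_space"
  assumes dim: "DIM('b) \<le> DIM('a)" and neg: "negligible (f ` S)"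
    and expand: "\<And>x. x \<in> S \<Longrightarrow> \<exists>c>0. \<exists>d>0. \<forall>y. norm (y - x) < d \<longrightarrow> c * norm (y - x) \<le> norm (f y - f x)"
  shows "negligible S"
proof -
  define T where "T n = {x\<in>S. \<forall>y. norm (y - x) < 1 / real (Suc n) \<longrightarrow>
                                    norm (y - x) \<le> real (Suc n) * norm (f y - f x)}" for n
  have "S \<subseteq> (\<Union>n. T n)"
  proof
    fix x assume x: "x \<in> S"
    then obtain c d where cd: "c > 0" "d > 0"
      "\<And>y. norm (y - x) < d \<Longrightarrow> c * norm (y - x) \<le> norm (f y - f x)" using expand by metis
    obtain n :: nat where n: "max (1 / c) (1 / d) < real n" using reals_Archimedean2 by blast
    have nc: "1 / c < real (Suc n)" and nd: "1 / d < real (Suc n)" using n by auto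
    have "x \<in> T n"
      unfolding T_def
    proof (intro CollectI conjI allI impI)
      fix y assume "norm (y - x) < 1 / real (Suc n)"
      also have "\<dots> < d" using nd cd by (simp add: field_simps)
      finally have *: "c * norm (y - x) \<le> norm (f y - f x)" by (rule cd)
      have "norm (y - x) = 1 / c * (c * norm (y - x))" using cd by simp
      also have "\<dots> \<le> 1 / c * norm (f y - f x)" using * cd by (intro mult_left_mono) auto
      also have "\<dots> \<le> real (Suc n) * norm (f y - f x)" using nc by (intro mult_right_mono) auto
      finally show "norm (y - x) \<le> real (Suc n) * norm (f y - f x)" .
    qed (rule x)
    then show "x \<in> (\<Union>n. T n)" by blast
  qed
  moreover have "negligible (T n)" for n
  proof (subst locally_negligible_alt, rule ballI)
    fix x assume x: "x \<in> T n"
    define V where "V = T n \<inter> ball x (1 / (2 * real (Suc n)))"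
    have close: "norm (y - z) \<le> real (Suc n) * norm (f y - f z)" if "y \<in> V" "z \<in> V" for y z
    proof -
      have "dist y z \<le> dist x y + dist x z" by (rule dist_triangle3)
      also have "\<dots> < 1 / (2 * real (Suc n)) + 1 / (2 * real (Suc n))"
        using that by (intro add_strict_mono) (simp_all add: V_def)
      also have "\<dots> = 1 / real (Suc n)" by (simp add: field_simps)
      finally have "dist y z < 1 / real (Suc n)" .
      then have "norm (y - z) < 1 / real (Suc n)" by (simp add: dist_norm)
      then show ?thesis using that by (auto simp: V_def T_def)
    qed
    have inj: "inj_on f V"
    proof (rule inj_onI)
      fix y z assume "y \<in> V" "z \<in> V" "f y = f z"
      then show "y = z" using close[of y z] by simp
    qed
    have "negligible (f ` V)"
      by (rule negligible_subset[OF neg]) (auto simp: V_def T_def)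
    moreover have "(real (Suc n))-lipschitz_on (f ` V) (the_inv_into V f)"
      using close inj by (intro lipschitz_onI) (auto simp: the_inv_into_f_f dist_norm)
    ultimately have "negligible (the_inv_into V f ` f ` V)"
      by (intro negligible_lipschitz_image[OF dim])
    then have "negligible V" using inj by (simp add: the_inv_into_f_f image_image)
    moreover have "openin (top_of_set (T n)) V"
      unfolding V_def by (rule openin_open_Int) simp
    moreover have "x \<in> V" using x by (simp add: V_def)
    ultimately show "\<exists>U. openin (top_of_set (T n)) U \<and> x \<in> U \<and> negligible U" by blast
  qed
  then have "negligible (\<Union>n. T n)" by (intro negligible_countable_Union) auto
  ultimately show ?thesis using negligible_subset by blast
qed

lemma expanding_at_if_injective_derivative:
  fixes f :: "'a::euclidean_space \<Rightarrow> 'b::euclidean_space"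
  assumes f: "(f has_derivative T) (at x)" and "inj T"
  shows "\<exists>c>0. \<exists>d>0. \<forall>y. norm (y - x) < d \<longrightarrow> c * norm (y - x) \<le> norm (f y - f x)"
proof -
  obtain B where B: "B > 0" "\<And>h. B * norm h \<le> norm (T h)"
    using linear_inj_bounded_below_pos[OF has_derivative_linear[OF f] \<open>inj T\<close>] by metis
  obtain d where d: "d > 0"
    "\<And>y. norm (y - x) < d \<Longrightarrow> norm (f y - f x - T (y - x)) \<le> B / 2 * norm (y - x)"
    using f B(1) unfolding has_derivative_at_alt by (metis half_gt_zero)
  have "B / 2 * norm (y - x) \<le> norm (f y - f x)" if "norm (y - x) < d" for y
    using d(2)[OF that] B(2)[of "y - x"] norm_triangle_ineq2[of "T (y - x)" "f y - f x"]
    by (simp add: norm_minus_commute)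
  then show ?thesis using B d by (intro exI[of _ "B / 2"] conjI exI[of _ d]) auto
qed

section \<open>Circles centred on a curve\<close>

definition unit_vec :: "real \<Rightarrow> real^2" where
  "unit_vec \<theta> = cos \<theta> *\<^sub>R axis 1 1 + sin \<theta> *\<^sub>R axis 2 1"

definition unit_normal :: "real \<Rightarrow> real^2" where
  "unit_normal \<theta> = (- sin \<theta>) *\<^sub>R axis 1 1 + cos \<theta> *\<^sub>R axis 2 1"

lemma axis_inner_2 [simp]:
  "axis 1 1 \<bullet> (axis 2 1 :: real^2) = 0" "axis 2 1 \<bullet> (axis 1 1 :: real^2) = 0"
  "axis 1 1 \<bullet> (axis 1 1 :: real^2) = 1" "axis 2 1 \<bullet> (axis 2 1 :: real^2) = 1"
  by (simp_all add: inner_axis_axis)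

lemma unit_vec_inner [simp]:
  "unit_vec \<theta> \<bullet> unit_vec \<theta> = 1" "unit_normal \<theta> \<bullet> unit_normal \<theta> = 1"
  "unit_normal \<theta> \<bullet> unit_vec \<theta> = 0"
  by (simp_all add: unit_vec_def unit_normal_def inner_add_left inner_add_right inner_diff_left inner_diff_right
      sin_cos_squared_add3)

lemma unit_vec_norm [simp]: "norm (unit_vec \<theta>) = 1" "norm (unit_normal \<theta>) = 1"
  by (simp_all add: norm_eq_sqrt_inner)

lemma unit_vec_derivative: "(unit_vec has_vector_derivative unit_normal \<theta>) (at \<theta>)"
  unfolding unit_vec_def unit_normal_def
  by (auto intro!: derivative_eq_intros simp: has_vector_derivative_def algebra_simps)

lemma unit_vec_lipschitz: "norm (unit_vec x - unit_vec y) \<le> \<bar>x - y\<bar>"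
proof -
  have "norm (unit_vec x - unit_vec y) \<le> 1 * norm (x - y)"
  proof (rule differentiable_bound[of UNIV])
    show "(unit_vec has_derivative (\<lambda>h. h *\<^sub>R unit_normal \<theta>)) (at \<theta> within UNIV)" for \<theta>
      using unit_vec_derivative by (simp add: has_vector_derivative_def)
    show "onorm (\<lambda>h. h *\<^sub>R unit_normal \<theta>) \<le> 1" for \<theta> by (rule onorm_le) simp
  qed auto
  then show ?thesis by simp
qed

lemma sphere_eq_range_unit_vec:
  fixes v :: "real^2"
  assumes "\<rho> \<ge> 0"
  shows "sphere v \<rho> = range (\<lambda>\<theta>. v + \<rho> *\<^sub>R unit_vec \<theta>)"
proof
  show "range (\<lambda>\<theta>. v + \<rho> *\<^sub>R unit_vec \<theta>) \<subseteq> sphere v \<rho>"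
    using assms by (auto simp: dist_norm)
  show "sphere v \<rho> \<subseteq> range (\<lambda>\<theta>. v + \<rho> *\<^sub>R unit_vec \<theta>)"
  proof
    fix w assume w: "w \<in> sphere v \<rho>"
    show "w \<in> range (\<lambda>\<theta>. v + \<rho> *\<^sub>R unit_vec \<theta>)"
    proof (cases "\<rho> = 0")
      case True
      then show ?thesis using w by auto
    next
      case False
      define u where "u = (1 / \<rho>) *\<^sub>R (w - v)"
      have "norm u = 1" using w False assms by (simp add: u_def dist_norm norm_minus_commute)
      then have "(u $ 1)\<^sup>2 + (u $ 2)\<^sup>2 = 1"
        by (simp add: norm_eq_sqrt_inner inner_vec_def sum_2 power2_eq_square)
      then obtain \<theta> where \<theta>: "u $ 1 = cos \<theta>" "u $ 2 = sin \<theta>" using sincos_total_2pi by metis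
      have "u = unit_vec \<theta>"
        using \<theta> by (simp add: vec_eq_iff forall_2 unit_vec_def axis_def)
      moreover have "w = v + \<rho> *\<^sub>R u" using False by (simp add: u_def)
      ultimately show ?thesis by blast
    qed
  qed
qed

definition circle_map :: "(real \<Rightarrow> real^2) \<Rightarrow> (real^2 \<Rightarrow> real) \<Rightarrow> real \<times> real \<Rightarrow> real^2" where
  "circle_map f r p = f (fst p) + r (f (fst p)) *\<^sub>R unit_vec (snd p)"

lemma circle_map_image:
  assumes "\<And>z. r z \<ge> 0"
  shows "circle_map f r ` (A \<times> UNIV) = (\<Union>v\<in>f ` A. sphere v (r v))"
proof -
  have "circle_map f r ` (A \<times> UNIV) = (\<Union>t\<in>A. range (\<lambda>\<theta>. f t + r (f t) *\<^sub>R unit_vec \<theta>))"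
    by (force simp: circle_map_def)
  then show ?thesis using assms by (simp add: sphere_eq_range_unit_vec)
qed

lemma circle_map_lipschitz:
  assumes lipf: "K-lipschitz_on UNIV f" and lipr: "L-lipschitz_on UNIV r" and r: "\<And>z. \<bar>r z\<bar> \<le> b"
  shows "(K + L * K + b)-lipschitz_on UNIV (circle_map f r)"
proof (rule lipschitz_onI)
  have [simp]: "K \<ge> 0" "L \<ge> 0" "b \<ge> 0"
    using lipf lipr r[of 0] by (auto intro: lipschitz_on_nonneg)
  then show "0 \<le> K + L * K + b" by simp
  fix p q :: "real \<times> real"
  have 1: "dist (f (fst p)) (f (fst q)) \<le> K * dist p q"
    using lipschitz_onD[OF lipf, of "fst p" "fst q"] dist_fst_le[of p q]
    by (meson \<open>K \<ge> 0\<close> UNIV_I mult_left_mono order_trans)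
  have "\<bar>r (f (fst p)) - r (f (fst q))\<bar> \<le> L * dist (f (fst p)) (f (fst q))"
    using lipschitz_onD[OF lipr, of "f (fst p)" "f (fst q)"] by (simp add: dist_real_def)
  also have "\<dots> \<le> L * (K * dist p q)" using 1 by (intro mult_left_mono) auto
  finally have 2: "\<bar>r (f (fst p)) - r (f (fst q))\<bar> \<le> L * K * dist p q" by simp
  have "norm (unit_vec (snd p) - unit_vec (snd q)) \<le> dist p q"
    using unit_vec_lipschitz[of "snd p" "snd q"] dist_snd_le[of p q] by (simp add: dist_real_def)
  then have 3: "\<bar>r (f (fst q))\<bar> * norm (unit_vec (snd p) - unit_vec (snd q)) \<le> b * dist p q"
    using r by (intro mult_mono) auto
  have "circle_map f r p - circle_map f r q = (f (fst p) - f (fst q))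
      + ((r (f (fst p)) - r (f (fst q))) *\<^sub>R unit_vec (snd p)
      + r (f (fst q)) *\<^sub>R (unit_vec (snd p) - unit_vec (snd q)))"
    by (simp add: circle_map_def algebra_simps)
  also have "norm \<dots> \<le> norm (f (fst p) - f (fst q))
      + (norm ((r (f (fst p)) - r (f (fst q))) *\<^sub>R unit_vec (snd p))
      + norm (r (f (fst q)) *\<^sub>R (unit_vec (snd p) - unit_vec (snd q))))"
    by (intro norm_triangle_mono order_refl)
  also have "\<dots> \<le> K * dist p q + (L * K * dist p q + b * dist p q)"
    using 1 2 3 by (intro add_mono) (auto simp: dist_norm)
  finally show "dist (circle_map f r p) (circle_map f r q) \<le> (K + L * K + b) * dist p q"
    by (simp add: dist_norm algebra_simps)
qed

text \<open>
  The derivative is invertible when the Jacobian is nonzero: the component of \<open>T h\<close> along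
  \<open>unit_vec\<close> is the first coordinate of \<open>h\<close> times the factor in \<open>J\<close>, and once that coordinate
  vanishes the normal component is the radius times the second coordinate.
\<close>
lemma circle_map_injective_derivative:
  assumes f: "(f has_vector_derivative f') (at (fst p))"
    and r: "(r has_derivative D) (at (f (fst p)))" and pos: "r (f (fst p)) \<noteq> 0"
    and J: "f' \<bullet> unit_vec (snd p) + D f' \<noteq> 0"
  shows "\<exists>T. (circle_map f r has_derivative T) (at p) \<and> inj T"
proof -
  define T where "T h = fst h *\<^sub>R f' + (r (f (fst p)) *\<^sub>R (snd h *\<^sub>R unit_normal (snd p))
      + D (fst h *\<^sub>R f') *\<^sub>R unit_vec (snd p))" for h :: "real \<times> real"
  have F: "((\<lambda>p. f (fst p)) has_derivative (\<lambda>h. fst h *\<^sub>R f')) (at p)"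
    using f unfolding has_vector_derivative_def
    by (rule has_derivative_compose[OF has_derivative_fst[OF has_derivative_ident]])
  have R: "((\<lambda>p. r (f (fst p))) has_derivative (\<lambda>h. D (fst h *\<^sub>R f'))) (at p)"
    using F r by (rule has_derivative_compose)
  have U: "((\<lambda>p. unit_vec (snd p)) has_derivative (\<lambda>h. snd h *\<^sub>R unit_normal (snd p))) (at p)"
    using unit_vec_derivative[of "snd p"] unfolding has_vector_derivative_def
    by (rule has_derivative_compose[OF has_derivative_snd[OF has_derivative_ident]])
  have der: "(circle_map f r has_derivative T) (at p)"
    unfolding circle_map_def[abs_def] T_def[abs_def]
    by (rule has_derivative_add[OF F has_derivative_scaleR[OF R U]])
  have "h = 0" if "T h = 0" for h
  proof -
    have D: "D (c *\<^sub>R f') = c * D f'" for c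
      using linear_scale[OF has_derivative_linear[OF r]] by simp
    have "0 = T h \<bullet> unit_vec (snd p)" using that by simp
    also have "\<dots> = fst h * (f' \<bullet> unit_vec (snd p) + D f')"
      unfolding T_def D inner_add_left inner_scaleR_left unit_vec_inner by (simp add: algebra_simps)
    finally have "fst h = 0" using J by simp
    then have "r (f (fst p)) *\<^sub>R (snd h *\<^sub>R unit_normal (snd p)) = 0"
      using that D[of 0] by (simp add: T_def)
    then have "snd h = 0" using pos by auto (metis norm_zero unit_vec_norm(2) zero_neq_one)
    then show "h = 0" using \<open>fst h = 0\<close> by (simp add: prod_eq_iff)
  qed
  then have "inj T" using linear_injective_0[OF has_derivative_linear[OF der]] by blast
  then show ?thesis using der by blast
qed

text \<open>
  The trigonometric polynomial in question is zero only if its coefficients are; the angles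
  \<open>0\<close>, \<open>pi / 2\<close> and \<open>pi\<close> already determine them.
\<close>
lemma exists_transverse_angle:
  fixes w :: "real^2"
  assumes "w \<noteq> 0"
  shows "\<exists>\<theta>. w \<bullet> unit_vec \<theta> + c \<noteq> 0"
proof (rule ccontr)
  assume "\<nexists>\<theta>. w \<bullet> unit_vec \<theta> + c \<noteq> 0"
  then have *: "w $ 1 * cos \<theta> + w $ 2 * sin \<theta> + c = 0" for \<theta>
    by (auto simp: unit_vec_def inner_add_right inner_axis mult.commute)
  have "w $ 1 = 0" "w $ 2 = 0"
    using *[of 0] *[of "pi / 2"] *[of pi] by auto
  then show False using assms by (simp add: vec_eq_iff forall_2)
qed

text \<open>
  The regular points of \<open>circle_map\<close> over \<open>A\<close> form a null set \<open>G\<close> because their image is null. Over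
  each parameter \<open>t\<close> with nonzero velocity the section of \<open>G\<close> contains a nonempty open set of angles,
  so by Fubini there are almost no such \<open>t\<close>.
\<close>
lemma negligible_regular_parameters:
  assumes r: "\<And>z. r differentiable (at z)" "\<And>z. r z > 0"
    and neg: "negligible (circle_map f r ` (A \<times> UNIV))"
  shows "negligible {t\<in>A. \<exists>f'. f' \<noteq> 0 \<and> (f has_vector_derivative f') (at t)}"
proof -
  define D where "D t = frechet_derivative r (at (f t))" for t
  have D: "(r has_derivative D t) (at (f t))" for t
    using r(1) unfolding D_def frechet_derivative_works .
  define G where "G = {p. fst p \<in> A \<and> (\<exists>f'. (f has_vector_derivative f') (at (fst p))
                         \<and> f' \<bullet> unit_vec (snd p) + D (fst p) f' \<noteq> 0)}"
  have "negligible G"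
  proof (rule negligible_of_negligible_image)
    show "negligible (circle_map f r ` G)"
      by (rule negligible_subset[OF neg]) (auto simp: G_def)
    fix p assume "p \<in> G"
    then obtain f' where "(f has_vector_derivative f') (at (fst p))"
        "f' \<bullet> unit_vec (snd p) + D (fst p) f' \<noteq> 0"
      by (auto simp: G_def)
    from circle_map_injective_derivative[OF this(1) D _ this(2)] r(2)
    obtain T where "(circle_map f r has_derivative T) (at p)" "inj T" by (metis less_irrefl)
    then show "\<exists>c>0. \<exists>d>0. \<forall>y. norm (y - p) < d \<longrightarrow>
        c * norm (y - p) \<le> norm (circle_map f r y - circle_map f r p)"
      by (rule expanding_at_if_injective_derivative)
  qed simp
  then have "negligible {t. \<not> negligible {\<theta>. (t, \<theta>) \<in> G}}" by (rule negligible_sections)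
  then show ?thesis
  proof (rule negligible_subset, intro subsetI CollectI notI)
    fix t assume "t \<in> {t\<in>A. \<exists>f'. f' \<noteq> 0 \<and> (f has_vector_derivative f') (at t)}"
      and sec: "negligible {\<theta>. (t, \<theta>) \<in> G}"
    then obtain f' where t: "t \<in> A" "f' \<noteq> 0" "(f has_vector_derivative f') (at t)" by auto
    let ?O = "{\<theta>. f' \<bullet> unit_vec \<theta> + D t f' \<noteq> 0}"
    have "continuous_on UNIV unit_vec"
      by (meson continuous_at_imp_continuous_on has_vector_derivative_continuous unit_vec_derivative)
    then have "open ?O" by (intro open_Collect_neq continuous_intros)
    moreover have "?O \<subseteq> {\<theta>. (t, \<theta>) \<in> G}" using t by (auto simp: G_def)
    then have "negligible ?O" using sec negligible_subset by blast
    ultimately have "?O = {}" using open_not_negligible by blast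
    then show False using exists_transverse_angle[OF t(2), of "D t f'"] by blast
  qed
qed

text \<open>
  Almost every parameter in \<open>A\<close> is critical for \<open>f\<close>: the exceptions have no derivative or a
  nonzero one, and both kinds form null sets, which \<open>f\<close> maps to sets of length zero.
\<close>
lemma hausdorff1_null_if_circles_negligible:
  fixes f :: "real \<Rightarrow> real^2" and r :: "real^2 \<Rightarrow> real"
  assumes r: "\<And>z. r differentiable (at z)" "\<And>z. r z > 0"
    and lip: "K-lipschitz_on UNIV f"
    and neg: "negligible (\<Union>v\<in>f ` A. sphere v (r v))"
  shows "hausdorff1 (f ` A) = 0"
proof -
  \<comment> \<open>Regular parameters, parameters without derivative, and critical parameters.\<close>
  define X where "X = {t\<in>A. \<exists>f'. f' \<noteq> 0 \<and> (f has_vector_derivative f') (at t)}"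
  define Y where "Y = {t. \<not> f differentiable (at t)}"
  define Z where "Z = {t. (f has_vector_derivative 0) (at t)}"
  have "negligible X"
    unfolding X_def using neg r
    by (intro negligible_regular_parameters) (auto simp: circle_map_image less_imp_le)
  moreover have "negligible Y" unfolding Y_def by (rule Rademacher_curve[OF lip])
  ultimately have "hausdorff1 (f ` (X \<union> Y)) = 0"
    by (intro hausdorff1_image_negligible[OF lip]) auto
  moreover have "hausdorff1 (f ` Z) = 0"
    by (rule hausdorff1_critical_values) (simp add: Z_def)
  ultimately have "hausdorff1 (f ` (X \<union> Y) \<union> f ` Z) = 0" by (rule hausdorff1_null_Un)
  moreover have "A \<subseteq> X \<union> Y \<union> Z"
  proof
    fix t assume "t \<in> A"
    show "t \<in> X \<union> Y \<union> Z"
    proof (cases "f differentiable (at t)")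
      case True
      then have "(f has_vector_derivative vector_derivative f (at t)) (at t)"
        by (simp add: vector_derivative_works)
      then show ?thesis using \<open>t \<in> A\<close>
        by (cases "vector_derivative f (at t) = 0") (auto simp: X_def Z_def)
    qed (simp add: Y_def)
  qed
  then have "f ` A \<subseteq> f ` (X \<union> Y) \<union> f ` Z" by blast
  ultimately show ?thesis by (rule hausdorff1_null_mono)
qed

theorem theorem4p2:
  fixes r :: "real^2 \<Rightarrow> real" and E :: "(real^2) set"
  assumes "admissible_radius r"
    and "one_rectifiable E"
    and "hausdorff1 E > 0"
  shows "emeasure lebesgue (\<Union>v\<in>E. sphere v (r v)) > 0"
proof -
  let ?C = "\<lambda>S. \<Union>v\<in>S. sphere v (r v)"
  obtain a b where ab: "0 < a" "\<And>z. a \<le> r z" "\<And>z. r z \<le> b" and diff: "\<And>z. r differentiable (at z)"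
    using assms(1) unfolding admissible_radius_def by auto
  have pos: "r z > 0" for z using ab(1) ab(2)[of z] by linarith
  obtain L where L: "L-lipschitz_on UNIV r" using admissible_radius_lipschitz[OF assms(1)] .
  obtain f :: "nat \<Rightarrow> real \<Rightarrow> real^2" where E: "E \<in> sets borel"
    and f: "\<And>j. \<exists>K. K-lipschitz_on UNIV (f j)"
    and null: "hausdorff1 (E - (\<Union>j::nat. range (f j))) = 0"
    using assms(2) unfolding one_rectifiable_def by blast
  define N where "N = E - (\<Union>j. range (f j))"
  define A where "A j = f j -` E" for j
  have EA: "E = (\<Union>j. f j ` A j) \<union> N" by (auto simp: A_def N_def)
  have CN: "negligible (?C N)"
    using null ab L unfolding N_def by (intro negligible_circles_over_null) auto
  have CA: "?C (f j ` A j) \<in> sets lebesgue" for j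
  proof -
    obtain K where K: "K-lipschitz_on UNIV (f j)" using f by blast
    have "\<bar>r z\<bar> \<le> b" for z using pos[of z] ab(3)[of z] by simp
    from circle_map_lipschitz[OF K L this]
    have lip: "(K + L * K + b)-lipschitz_on UNIV (circle_map (f j) r)" .
    have "f j \<in> borel_measurable borel"
      using K by (intro borel_measurable_continuous_onI lipschitz_on_continuous_on)
    then have "A j \<in> sets borel"
      unfolding A_def using E measurable_sets_borel by blast
    then have "A j \<times> (UNIV :: real set) \<in> sets (borel \<Otimes>\<^sub>M borel)" by (intro pair_measureI) auto
    then have "A j \<times> (UNIV :: real set) \<in> sets lborel"
      unfolding borel_prod by simp
    then have "A j \<times> (UNIV :: real set) \<in> sets lebesgue"
      by (rule sets_completionI_sets)
    then have "circle_map (f j) r ` (A j \<times> UNIV) \<in> sets lebesgue"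
      using negligible_lipschitz_image[OF _ _ lipschitz_on_subset[OF lip]]
      by (intro sets_lebesgue_continuous_image[OF _ lipschitz_on_continuous_on[OF lip]]) auto
    then show ?thesis using pos by (simp add: circle_map_image less_imp_le)
  qed
  have C: "?C E = (\<Union>j. ?C (f j ` A j)) \<union> ?C N" by (subst EA) blast
  have "(\<Union>j. ?C (f j ` A j)) \<in> sets lebesgue"
    using CA by (intro sets.countable_UN) blast
  then have meas: "?C E \<in> sets lebesgue"
    unfolding C using negligible_imp_sets[OF CN] by (rule sets.Un)
  show ?thesis
  proof (rule ccontr)
    assume "\<not> emeasure lebesgue (?C E) > 0"
    then have "negligible (?C E)" using meas by (simp add: negligible_iff_emeasure0)
    then have neg: "negligible (?C (f j ` A j))" for j
      by (rule negligible_subset) (use C in blast)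
    have "hausdorff1 (f j ` A j) = 0" for j
      using f[of j] hausdorff1_null_if_circles_negligible[OF diff pos _ neg] by blast
    then have "hausdorff1 (\<Union>j. f j ` A j) = 0" by (rule hausdorff1_null_UN)
    then have "hausdorff1 E = 0"
      using null unfolding N_def[symmetric] by (subst EA) (rule hausdorff1_null_Un)
    then show False using assms(3) by simp
  qed
qed

end
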